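(* Let $\vec F$ be an acyclically oriented graph with $1<m_2(\vec F)<2$, and let $\vec{\mathrm{TT}}_3'$ be the transitive tournament on $3$ vertices rooted at an arbitrary one of its vertices. Then $$p_{\vec F\circ\vec{\mathrm{TT}}_3'}\ll n^{-1/m_2(\vec F\circ\vec{\mathrm{TT}}_3')}.$$
   Context: An oriented graph is an orientation of a finite simple graph (each edge receives exactly one of its two directions); it is acyclically oriented (acyclic) if it contains no directed cycle. For a graph $G$ and an oriented graph $\vec H$, $G\to\vec H$ means that every orientation of $G$ contains a copy of $\vec H$, i.e. a (not necessarily induced) subdigraph isomorphic to $\vec H$. $G(n,p)$ is the binomial random graph on $n$ vertices, in which each edge of $K_n$ is present independently with probability $p$. For functions $a,b$ of $n$, $a\ll b$ (equivalently $b\gg a$) means $\lim_{n\to\infty}a(n)/b(n)=0$. For an acyclic oriented graph $\vec H$, $p_{\vec H}=p_{\vec H}(n)$ denotes the threshold for the property $G(n,p)\to\vec H$, that is, a function (unique up to constant factors) such that $\lim_{n\to\infty}\mathbb P(G(n,p)\to\vec H)$ equals $0$ if $p\ll p_{\vec H}$ and equals $1$ if $p\gg p_{\vec H}$. For a graph $J$, $v(J)$ and $e(J)$ denote its numbers of vertices and edges. Let $\rho_2(J)=(e(J)-1)/(v(J)-2)$ if $v(J)\ge 3$, and let $\rho_2(K_1)=\rho_2(2K_1)=0$ and $\rho_2(K_2)=1/2$. The maximum $2$-density of a graph $H$ is $m_2(H)=\max\{\rho_2(J):J\subseteq H\}$, the maximum over subgraphs $J$ of $H$ with at least one vertex (possibly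 $J=H$). For an oriented graph $\vec H$ with underlying undirected graph $H$, $m_2(\vec H)=m_2(H)$. A rooted oriented graph is an oriented graph with a distinguished vertex, its root. For an oriented graph $\vec F$ and a rooted oriented graph $\vec H$ with root $r$, the rooted product $\vec F\circ\vec H$ is the oriented graph with vertex set $V(\vec F)\times V(\vec H)$ and arc set $$\{((f,r),(f',r)):(f,f')\in E(\vec F)\}\cup\bigcup_{x\in V(\vec F)}\{((x,h),(x,h')):(h,h')\in E(\vec H)\}.$$ *)

theory Defs
  imports
    "HOL-Probability.Probability"
    "Graph_Theory.Pair_Digraph"
    "Graph_Theory.Digraph_Isomorphism"
begin

record 'a ugraph =
  uverts :: "'a set"
  uedges :: "'a set set"

definition simple_graph :: "'a ugraph \<Rightarrow> bool" where
  "simple_graph G \<longleftrightarrow> finite (uverts G) \<and> (\<forall>e\<in>uedges G. e \<subseteq> uverts G \<and> card e = 2)"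

definition usubgraph :: "'a ugraph \<Rightarrow> 'a ugraph \<Rightarrow> bool" where
  "usubgraph J H \<longleftrightarrow> simple_graph J \<and> uverts J \<subseteq> uverts H \<and> uedges J \<subseteq> uedges H"

definition rho2 :: "'a ugraph \<Rightarrow> real" where
  "rho2 J =
     (if card (uverts J) \<ge> 3
      then (real (card (uedges J)) - 1) / (real (card (uverts J)) - 2)
      else if card (uverts J) = 2 \<and> card (uedges J) = 1 then 1 / 2 else 0)"

text \<open>Only meaningful for a finite simple graph with at least one vertex: otherwise the set
  below may be empty or infinite.\<close>

definition m2 :: "'a ugraph \<Rightarrow> real" where
  "m2 H = Max {rho2 J | J. usubgraph J H \<and> uverts J \<noteq> {}}"

definition underlying :: "'a pair_pre_digraph \<Rightarrow> 'a ugraph" where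
  "underlying D = \<lparr> uverts = pverts D, uedges = {{u, v} | u v. (u, v) \<in> parcs D} \<rparr>"

text \<open>The locale \<^locale>\<open>pair_digraph\<close> provides finiteness and excludes loops; what remains is
  that no edge carries both directions.\<close>

definition oriented_graph :: "'a pair_pre_digraph \<Rightarrow> bool" where
  "oriented_graph D \<longleftrightarrow> pair_digraph D \<and> (\<forall>u v. (u, v) \<in> parcs D \<longrightarrow> (v, u) \<notin> parcs D)"

definition acyclically_oriented :: "'a pair_pre_digraph \<Rightarrow> bool" where
  "acyclically_oriented D \<longleftrightarrow> oriented_graph D \<and> (\<nexists>c. pre_digraph.cycle (with_proj D) c)"

definition orientation_of :: "'a pair_pre_digraph \<Rightarrow> 'a ugraph \<Rightarrow> bool" where
  "orientation_of D G \<longleftrightarrow> oriented_graph D \<and> underlying D = G"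

definition contains_copy :: "'a pair_pre_digraph \<Rightarrow> 'b pair_pre_digraph \<Rightarrow> bool" where
  "contains_copy D H \<longleftrightarrow>
     (\<exists>K :: 'a pair_pre_digraph.
        subgraph (with_proj K) (with_proj D) \<and> digraph_iso (with_proj H) (with_proj K))"

definition arrows :: "'a ugraph \<Rightarrow> 'b pair_pre_digraph \<Rightarrow> bool" where
  "arrows G H \<longleftrightarrow> (\<forall>D. orientation_of D G \<longrightarrow> contains_copy D H)"

definition complete_edges :: "nat \<Rightarrow> nat set set" where
  "complete_edges n = {e. e \<subseteq> {..<n} \<and> card e = 2}"

definition gnp :: "nat \<Rightarrow> real \<Rightarrow> nat ugraph pmf" where
  "gnp n p =
     map_pmf (\<lambda>X. \<lparr> uverts = {..<n}, uedges = {e \<in> complete_edges n. X e} \<rparr>)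
       (Pi_pmf (complete_edges n) False (\<lambda>_. bernoulli_pmf p))"

text \<open>The nonvanishing condition guards against the convention \<open>x / 0 = 0\<close>.\<close>

definition much_less :: "(nat \<Rightarrow> real) \<Rightarrow> (nat \<Rightarrow> real) \<Rightarrow> bool" (infix \<open>\<lless>\<close> 50) where
  "a \<lless> b \<longleftrightarrow> eventually (\<lambda>n. b n \<noteq> 0) sequentially \<and> (\<lambda>n. a n / b n) \<longlonglongrightarrow> 0"

text \<open>A threshold is unique only up to constant factors, hence a predicate on functions rather
  than a function of the property. The values of a threshold need not be probabilities.\<close>

definition is_threshold :: "(nat ugraph \<Rightarrow> bool) \<Rightarrow> (nat \<Rightarrow> real) \<Rightarrow> bool" where
  "is_threshold P t \<longleftrightarrow>
     eventually (\<lambda>n. t n > 0) sequentially \<and>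
     (\<forall>p. (\<forall>n. 0 \<le> p n \<and> p n \<le> 1) \<longrightarrow>
        (p \<lless> t \<longrightarrow> (\<lambda>n. measure_pmf.prob (gnp n (p n)) {G. P G}) \<longlonglongrightarrow> 0) \<and>
        (t \<lless> p \<longrightarrow> (\<lambda>n. measure_pmf.prob (gnp n (p n)) {G. P G}) \<longlonglongrightarrow> 1))"

text \<open>The third argument is the root of the second factor.\<close>

definition rooted_product ::
    "'a pair_pre_digraph \<Rightarrow> 'b pair_pre_digraph \<Rightarrow> 'b \<Rightarrow> ('a \<times> 'b) pair_pre_digraph" where
  "rooted_product F H r =
     \<lparr> pverts = pverts F \<times> pverts H,
       parcs = {((f, r), (f', r)) | f f'. (f, f') \<in> parcs F} \<union>
         (\<Union>x\<in>pverts F. {((x, h), (x, h')) | h h'. (h, h') \<in> parcs H}) \<rparr>"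

definition transitive_tournament :: "nat \<Rightarrow> nat pair_pre_digraph" where
  "transitive_tournament k = \<lparr> pverts = {..<k}, parcs = {(i, j). i < j \<and> j < k} \<rparr>"

end

theory Submission
  imports Defs "HOL-Real_Asymp.Real_Asymp"
begin

text \<open>
  Since the rooted product contains a triangle, its 2-density is at least 2, so it suffices to
  find a density \<open>q = n^(-a)\<close> with \<open>a > 1/2\<close> at which \<open>G(n,q)\<close> arrows the rooted product with
  probability at least 1/2; playing \<open>q\<close> against the threshold along a subsequence then gives the
  claim.

  Every tournament on 4 vertices contains a transitive triangle, and for \<open>a\<close> close to 1/2 the
  second moment method yields \<open>n^s\<close> pairwise disjoint copies of \<open>K\<^sub>4\<close> for every \<open>s < 4 - 6 a\<close>. An
  orientation of the random graph thus has a set \<open>U\<close> of \<open>n^s\<close> vertices that are roots of disjoint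
  transitive triangles. As \<open>d = m\<^sub>2(F) < 2\<close>, one can choose \<open>s > a d\<close>; then a copy of \<open>F\<close> is forced
  inside every vertex set of this size. Indeed, by the method of hypergraph containers every
  orientation of \<open>U\<close> without a copy of \<open>F\<close> lies in one of at most \<open>exp (O(|U|^(2 - 1/d) log |U|))\<close>
  digraphs with few copies of \<open>F\<close>; supersaturation shows that each of them misses a positive
  proportion of all pairs, and the union bound over all \<open>U\<close> and all containers is beaten by
  \<open>exp (- \<Omega>(q |U|^2))\<close>.
\<close>

section \<open>Hypergraph containers\<close>

text \<open>Why some \<open>a > 1/2\<close> works: at a = 1/2 the expected number n^(4 - 6a) of
  copies of K_4 is of order n, while forcing F needs more than n^(a d) = n^(d/2) vertices. The bound
  d < 2 leaves a gap between these exponents that survives a small increase of a; they meet at a = 4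
  / (d + 6). K_4 replaces the triangle because a triangle may be oriented cyclically. The obstacle
  is that the set U of roots depends on the orientation, hence on the graph, so the forcing must
  hold for all U of the given size at once. Choosing U costs exp(|U| log n), which q |U|^2 beats
  once s > a; this follows from d > 1. A union bound over the orientations of a fixed U would cost
  exp of the number of its edges, about q |U|^2, which is of the same order as the gain. Containers
  lower this to |U|^(2 - 1/d) up to a logarithm, and s > a d is what makes that negligible. The
  hypergraph has ordered pairs of elements of U as vertices and the arc sets of embedded copies of F
  as edges. A pair that a container misses in both directions has to be a non-edge of the random
  graph, and that is the event whose probability is estimated.\<close>

lemma sum_UN_le:
  fixes f :: "'b \<Rightarrow> real"
  assumes "finite A" "\<And>a. a \<in> A \<Longrightarrow> finite (B a)" "\<And>x. 0 \<le> f x"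
  shows "sum f (\<Union>a\<in>A. B a) \<le> (\<Sum>a\<in>A. sum f (B a))"
  using assms(1,2)
proof (induction A rule: finite_induct)
  case (insert a A)
  have "sum f (B a \<union> (\<Union>a\<in>A. B a)) \<le> sum f (B a) + sum f (\<Union>a\<in>A. B a)"
    using insert assms(3) by (subst sum_Un) (auto simp: sum_nonneg)
  then show ?case using insert by simp
qed simp

lemma sum_le_sum_superset:
  fixes f :: "'b \<Rightarrow> real"
  assumes "finite A" "finite B" "\<And>x. 0 \<le> f x" "\<And>x. x \<in> A \<Longrightarrow> x \<notin> B \<Longrightarrow> f x = 0"
  shows "sum f A \<le> sum f B"
proof -
  have "sum f A = sum f (A \<inter> B)"
    using assms by (intro sum.mono_neutral_right) auto
  also have "\<dots> \<le> sum f B"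
    using assms by (intro sum_mono2) auto
  finally show ?thesis .
qed

definition wdeg :: "'v set \<Rightarrow> ('v set \<Rightarrow> real) \<Rightarrow> 'v set \<Rightarrow> real" where
  "wdeg V w T = (\<Sum>e\<in>{e. e \<subseteq> V \<and> T \<subseteq> e}. w e)"

text \<open>The usual codegree hypothesis Delta_j <= K q^(j-1) e(H) / v(H) of the container method,
  with total weight normalised to at least 1. \<open>M\<close> stands for v(H) but is kept apart
  from \<open>card V\<close>, so that it can stay at |U|^2 while the host digraph shrinks. Weights
  are real because links are added up and because different embeddings may share an arc set.\<close>

definition spread :: "'v set \<Rightarrow> ('v set \<Rightarrow> real) \<Rightarrow> nat \<Rightarrow> real \<Rightarrow> nat \<Rightarrow> real \<Rightarrow> bool" where
  "spread V w l q M K \<longleftrightarrow>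
     finite V \<and> (\<forall>e. 0 \<le> w e) \<and> (\<forall>e. w e \<noteq> 0 \<longrightarrow> e \<subseteq> V \<and> card e = l) \<and> 1 \<le> sum w (Pow V) \<and>
     (\<forall>T. T \<subseteq> V \<longrightarrow> T \<noteq> {} \<longrightarrow> wdeg V w T \<le> K * q ^ (card T - 1) / M)"

definition w_indep :: "('v set \<Rightarrow> real) \<Rightarrow> 'v set \<Rightarrow> bool" where
  "w_indep w I \<longleftrightarrow> (\<forall>e. e \<subseteq> I \<longrightarrow> w e = 0)"

lemma wdeg_empty: "wdeg V w {} = sum w (Pow V)"
  by (simp add: wdeg_def Pow_def)

lemma wdeg_eq_sum_if: "finite V \<Longrightarrow> wdeg V w T = (\<Sum>e\<in>Pow V. if T \<subseteq> e then w e else 0)"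
  unfolding wdeg_def by (subst sum.inter_filter [symmetric]) (auto intro!: sum.cong)

lemma wdeg_add: "wdeg V (\<lambda>e. f e + g e) T = wdeg V f T + wdeg V g T"
  by (simp add: wdeg_def sum.distrib)

lemma wdeg_scale: "wdeg V (\<lambda>e. c * f e) T = c * wdeg V f T"
  by (simp add: wdeg_def sum_distrib_left)

text \<open>Double counting: an edge of size \<open>l\<close> has only 2^l subsets T.\<close>

lemma sum_wdeg_subsets_le:
  assumes V: "finite V" and nn: "\<And>e. 0 \<le> w e" and unif: "\<And>e. w e \<noteq> 0 \<Longrightarrow> card e = l"
    and \<T>: "\<T> \<subseteq> Pow V"
  shows "(\<Sum>T\<in>\<T>. wdeg V w T) \<le> 2 ^ l * sum w (Pow V)"
proof -
  have "(\<Sum>T\<in>\<T>. wdeg V w T) = (\<Sum>T\<in>\<T>. \<Sum>e\<in>Pow V. if T \<subseteq> e then w e else 0)"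
    using V by (simp add: wdeg_eq_sum_if)
  also have "\<dots> = (\<Sum>e\<in>Pow V. \<Sum>T\<in>\<T>. if T \<subseteq> e then w e else 0)"
    by (rule sum.swap)
  also have "\<dots> \<le> (\<Sum>e\<in>Pow V. 2 ^ l * w e)"
  proof (rule sum_mono)
    fix e assume e: "e \<in> Pow V"
    have fin: "finite \<T>" "finite e"
      using V \<T> e by (auto intro: finite_subset)
    have "(\<Sum>T\<in>\<T>. if T \<subseteq> e then w e else 0) = real (card {T \<in> \<T>. T \<subseteq> e}) * w e"
      using fin by (subst sum.inter_filter [symmetric]) auto
    also have "\<dots> \<le> 2 ^ l * w e"
    proof (cases "w e = 0")
      case False
      have "card {T \<in> \<T>. T \<subseteq> e} \<le> card (Pow e)"
        using fin by (intro card_mono) auto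
      then have "card {T \<in> \<T>. T \<subseteq> e} \<le> 2 ^ l"
        using fin unif[OF False] by (simp add: card_Pow)
      then have "real (card {T \<in> \<T>. T \<subseteq> e}) \<le> 2 ^ l"
        by (metis of_nat_le_iff of_nat_numeral of_nat_power)
      then show ?thesis using nn by (intro mult_right_mono) auto
    qed simp
    finally show "(\<Sum>T\<in>\<T>. if T \<subseteq> e then w e else 0) \<le> 2 ^ l * w e" .
  qed
  finally show ?thesis by (simp add: sum_distrib_left)
qed

text \<open>
  One round of the container algorithm. A list \<open>S\<close> of vertices of an independent set \<open>I\<close> serves as
  a fingerprint: \<open>build S\<close> adds up the links of its members, discarding edges through vertex sets
  that are already saturated, so that the result is again spread, has uniformity lowered by one,
  and still has \<open>I\<close> as an independent set. If no vertex of \<open>I\<close> has a large link left, then \<open>I\<close> lies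
  in \<open>cont S\<close>.
\<close>

locale container_step =
  fixes V :: "'v set" and w :: "'v set \<Rightarrow> real" and l :: nat and q :: real and M :: nat and K :: real
  assumes spread: "spread V w (Suc l) q M K"
    and K: "1 \<le> K" and q: "0 < q" and qM: "1 \<le> q * M" and l: "1 \<le> l"
begin

text \<open>Calibrated for \<open>dirty_weight_le\<close>, whose estimate ends in 2^(l+1) K^2 /
  \<open>\<sigma>\<close> = 1/4.\<close>

definition \<sigma> :: real where "\<sigma> = 2 ^ (l + 3) * K\<^sup>2"

text \<open>The exponent is \<open>card T\<close>, not \<open>card T - 1\<close>: the sum of links
  has total weight of order q and is rescaled to order 1 only in
  \<open>spread_build\<close>.\<close>

definition saturated :: "('v set \<Rightarrow> real) \<Rightarrow> 'v set \<Rightarrow> bool" where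
  "saturated L T \<longleftrightarrow> \<sigma> * q ^ card T / M \<le> wdeg V L T"

definition clean :: "('v set \<Rightarrow> real) \<Rightarrow> 'v set \<Rightarrow> bool" where
  "clean L e \<longleftrightarrow> (\<forall>T. T \<subseteq> e \<longrightarrow> T \<noteq> {} \<longrightarrow> \<not> saturated L T)"

definition link :: "('v set \<Rightarrow> real) \<Rightarrow> 'v \<Rightarrow> 'v set \<Rightarrow> real" where
  "link L v e = (if e \<subseteq> V \<and> v \<in> V \<and> v \<notin> e \<and> clean L e then w (insert v e) else 0)"

definition avail :: "('v set \<Rightarrow> real) \<Rightarrow> 'v \<Rightarrow> real" where
  "avail L v = sum (link L v) (Pow V)"

text \<open>Lists grow at the head, so the link of \<open>v\<close> is cleaned against the weight
  that the tail has already built.\<close>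

primrec build :: "'v list \<Rightarrow> 'v set \<Rightarrow> real" where
  "build [] = (\<lambda>_. 0)"
| "build (v # S) = (\<lambda>e. build S e + link (build S) v e)"

text \<open>A vertex may occur repeatedly; what matters is that every entry contributes weight at
  least 1 / (4 M).\<close>

primrec good_seq :: "'v list \<Rightarrow> bool" where
  "good_seq [] = True"
| "good_seq (v # S) = (good_seq S \<and> v \<in> V \<and> 1 / (4 * M) \<le> avail (build S) v)"

lemma finV: "finite V" and w_nonneg: "0 \<le> w e" and w_supp: "w e \<noteq> 0 \<Longrightarrow> e \<subseteq> V"
  and w_unif: "w e \<noteq> 0 \<Longrightarrow> card e = Suc l" and w_total: "1 \<le> sum w (Pow V)"
  and w_deg: "T \<subseteq> V \<Longrightarrow> T \<noteq> {} \<Longrightarrow> wdeg V w T \<le> K * q ^ (card T - 1) / M"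
  using spread unfolding spread_def by auto

lemma M_pos: "0 < M"
  using qM by (cases M) auto

lemma link_nonneg: "0 \<le> link L v e"
  by (simp add: link_def w_nonneg)

lemma link_supp: "link L v e \<noteq> 0 \<Longrightarrow> e \<subseteq> V \<and> card e = l"
  using w_unif[of "insert v e"] finV by (auto simp: link_def card_insert_if finite_subset split: if_splits)

lemma build_nonneg: "0 \<le> build S e"
  by (induction S) (auto simp: link_nonneg)

lemma build_supp: "build S e \<noteq> 0 \<Longrightarrow> e \<subseteq> V \<and> card e = l"
  by (induction S) (use link_supp in fastforce)+

text \<open>\<open>insert v\<close> is injective on the sets that avoid \<open>v\<close> and sends
  the link edges above \<open>T\<close> to edges above \<open>insert v T\<close>.\<close>

lemma wdeg_link_le:
  assumes "T \<subseteq> V" "v \<in> V" "v \<notin> T"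
  shows "wdeg V (link L v) T \<le> wdeg V w (insert v T)"
proof -
  have "wdeg V (link L v) T = (\<Sum>e | e \<subseteq> V \<and> T \<subseteq> e \<and> v \<notin> e. link L v e)"
    unfolding wdeg_def using finV by (intro sum.mono_neutral_right) (auto simp: link_def)
  also have "\<dots> \<le> (\<Sum>e | e \<subseteq> V \<and> T \<subseteq> e \<and> v \<notin> e. w (insert v e))"
    by (rule sum_mono) (auto simp: link_def w_nonneg)
  also have "\<dots> = sum w (insert v ` {e. e \<subseteq> V \<and> T \<subseteq> e \<and> v \<notin> e})"
  proof (subst sum.reindex)
    show "inj_on (insert v) {e. e \<subseteq> V \<and> T \<subseteq> e \<and> v \<notin> e}"
      by (rule inj_onI) (metis (no_types, lifting) Diff_insert_absorb mem_Collect_eq)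
  qed simp
  also have "\<dots> \<le> wdeg V w (insert v T)"
    unfolding wdeg_def using finV assms by (intro sum_mono2) (auto simp: w_nonneg)
  finally show ?thesis .
qed

text \<open>Adding \<open>v\<close> to \<open>T\<close> raises the exponent by one. The case
  \<open>T = {}\<close> is included and bounds the total weight of one link by K / M.\<close>

lemma wdeg_link_le_spread: 
  assumes T: "T \<subseteq> V" and v: "v \<in> V"
  shows "wdeg V (link L v) T \<le> K * q ^ card T / M"
proof (cases "v \<in> T")
  case True
  then have "wdeg V (link L v) T = 0"
    unfolding wdeg_def by (intro sum.neutral) (auto simp: link_def)
  then show ?thesis using K q by simp
next
  case False
  have "card (insert v T) - 1 = card T"
    using False T finV by (simp add: finite_subset)
  then show ?thesis
    using wdeg_link_le[OF T v False, of L] w_deg[of "insert v T"] T v by fastforce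
qed

text \<open>Once \<open>T\<close> is saturated, no later link adds weight above it, so the threshold
  is overshot by at most one link, that is, by K q^|T| / M.\<close>

lemma wdeg_build_le:
  assumes "set S \<subseteq> V" and T: "T \<subseteq> V" "T \<noteq> {}"
  shows "wdeg V (build S) T \<le> (\<sigma> + K) * q ^ card T / M"
  using assms(1)
proof (induction S)
  case Nil
  then show ?case using K q by (simp add: wdeg_def \<sigma>_def)
next
  case (Cons v S)
  show ?case
  proof (cases "saturated (build S) T")
    case True
    then have "wdeg V (link (build S) v) T = 0"
      unfolding wdeg_def using T(2) by (intro sum.neutral) (auto simp: link_def clean_def)
    then show ?thesis using Cons by (simp add: wdeg_add)
  next
    case False
    then have "wdeg V (build S) T \<le> \<sigma> * q ^ card T / M"
      by (simp add: saturated_def)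
    moreover have "wdeg V (link (build S) v) T \<le> K * q ^ card T / M"
      using Cons.prems T by (intro wdeg_link_le_spread) auto
    ultimately show ?thesis by (simp add: wdeg_add algebra_simps add_divide_distrib)
  qed
qed

lemma total_build_le:
  assumes "set S \<subseteq> V"
  shows "sum (build S) (Pow V) \<le> length S * K / M"
  using assms
proof (induction S)
  case (Cons v S)
  have "sum (link (build S) v) (Pow V) \<le> K / M"
    using wdeg_link_le_spread[of "{}" v "build S"] Cons.prems by (simp add: wdeg_empty)
  then show ?case using Cons by (simp add: sum.distrib algebra_simps add_divide_distrib)
qed simp

lemma total_build_ge:
  assumes "good_seq S"
  shows "real (length S) / (4 * M) \<le> sum (build S) (Pow V)"
  using assms
  by (induction S) (auto simp: sum.distrib avail_def add_divide_distrib)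

lemma good_seq_subset: "good_seq S \<Longrightarrow> set S \<subseteq> V"
  by (induction S) auto

text \<open>If \<open>e\<close> lies in \<open>I\<close> and \<open>v\<close> is in
  \<open>I\<close>, then \<open>insert v e\<close> lies in \<open>I\<close> as well, so the link of
  \<open>v\<close> gives \<open>e\<close> no weight.\<close>

lemma w_indep_build:
  assumes "w_indep w I" "set S \<subseteq> I"
  shows "w_indep (build S) I"
  using assms(2)
  by (induction S) (use assms(1) in \<open>auto simp: w_indep_def link_def\<close>)

definition cont :: "'v list \<Rightarrow> 'v set" where
  "cont S = {v \<in> V. avail (build S) v < 1 / (4 * M)}"

text \<open>The length of a full fingerprint: q M entries of weight at least 1 / (4 M) accumulate
  weight of order q, the scale at which saturation is measured.\<close>

definition m :: nat where "m = nat \<lceil>q * M\<rceil>"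

lemma m_bounds: "q * M \<le> m" "real m \<le> 2 * (q * M)" "1 \<le> m"
  using qM unfolding m_def by linarith+

text \<open>A dirty edge contains a saturated set \<open>T\<close>. Saturation bounds the
  \<open>w\<close>-degree of \<open>T\<close> by K / (\<open>\<sigma>\<close> q) times its degree in
  \<open>build S\<close>, and the latter degrees sum to at most 2^l times the total built weight,
  which is at most 2 q K.\<close>

lemma dirty_weight_le:
  assumes S: "set S \<subseteq> V" and len: "length S \<le> m"
  shows "(\<Sum>e | e \<subseteq> V \<and> \<not> clean (build S) e. w e) \<le> 1 / 4"
proof -
  define \<T> where "\<T> = {T. T \<subseteq> V \<and> T \<noteq> {} \<and> saturated (build S) T}"
  have fin\<T>: "finite \<T>" using finV by (auto simp: \<T>_def)
  have Mp: "real M > 0" using M_pos by simp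
  have \<sigma>p: "\<sigma> > 0" using K by (simp add: \<sigma>_def)
  have "(\<Sum>e | e \<subseteq> V \<and> \<not> clean (build S) e. w e) \<le> (\<Sum>e\<in>(\<Union>T\<in>\<T>. {e. e \<subseteq> V \<and> T \<subseteq> e}). w e)"
    using finV by (intro sum_mono2) (fastforce simp: \<T>_def clean_def w_nonneg)+
  also have "\<dots> \<le> (\<Sum>T\<in>\<T>. wdeg V w T)"
    unfolding wdeg_def using finV fin\<T> by (intro sum_UN_le) (auto simp: w_nonneg)
  also have "\<dots> \<le> (\<Sum>T\<in>\<T>. K / (\<sigma> * q) * wdeg V (build S) T)"
  proof (rule sum_mono)
    fix T assume T: "T \<in> \<T>"
    then have fT: "finite T" "T \<noteq> {}" using finV by (auto simp: \<T>_def finite_subset)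
    have "wdeg V w T \<le> K * q ^ (card T - 1) / M"
      using T by (intro w_deg) (auto simp: \<T>_def)
    also have "\<dots> = K / (\<sigma> * q) * (\<sigma> * q ^ card T / M)"
      using fT \<sigma>p q by (cases "card T") (auto simp: field_simps)
    also have "\<dots> \<le> K / (\<sigma> * q) * wdeg V (build S) T"
      using T \<sigma>p q K by (intro mult_left_mono) (auto simp: \<T>_def saturated_def)
    finally show "wdeg V w T \<le> K / (\<sigma> * q) * wdeg V (build S) T" .
  qed
  also have "\<dots> = K / (\<sigma> * q) * (\<Sum>T\<in>\<T>. wdeg V (build S) T)"
    by (simp add: sum_distrib_left)
  also have "\<dots> \<le> K / (\<sigma> * q) * (2 ^ l * (2 * q * K))"
  proof (rule mult_left_mono)
    have "(\<Sum>T\<in>\<T>. wdeg V (build S) T) \<le> 2 ^ l * sum (build S) (Pow V)"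
      using finV build_nonneg build_supp by (intro sum_wdeg_subsets_le) (auto simp: \<T>_def)
    also have "\<dots> \<le> 2 ^ l * (length S * K / M)"
      using total_build_le[OF S] by (intro mult_left_mono) auto
    also have "\<dots> \<le> 2 ^ l * (2 * (q * M) * K / M)"
      using len m_bounds K Mp by (intro mult_left_mono divide_right_mono mult_right_mono) auto
    also have "\<dots> = 2 ^ l * (2 * q * K)" using Mp by simp
    finally show "(\<Sum>T\<in>\<T>. wdeg V (build S) T) \<le> 2 ^ l * (2 * q * K)" .
  qed (use K \<sigma>p q in auto)
  also have "\<dots> = 1 / 4"
    using K q by (simp add: \<sigma>_def field_simps power2_eq_square power_add)
  finally show ?thesis .
qed

text \<open>Of the total weight 1, dirty edges carry at most 1/4, and clean edges meeting the
  container at most |C| / (4 M) <= 1/4. So clean edges inside \<open>V - cont S\<close> carry at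
  least 1/2, while each vertex there accounts for at most K / M.\<close>

lemma card_cont:
  assumes S: "set S \<subseteq> V" and len: "length S \<le> m" and VM: "card V \<le> M"
  shows "real M / (2 * K) \<le> card (V - cont S)"
proof -
  define C where "C = cont S"
  have CV: "C \<subseteq> V" by (auto simp: C_def cont_def)
  have Mp: "real M > 0" using M_pos by simp
  let ?clean = "\<lambda>e. clean (build S) e"
  have cleanC: "(\<Sum>e | e \<subseteq> V \<and> ?clean e \<and> e \<inter> C \<noteq> {}. w e) \<le> 1 / 4"
  proof -
    have "(\<Sum>e | e \<subseteq> V \<and> ?clean e \<and> e \<inter> C \<noteq> {}. w e)
        \<le> (\<Sum>e\<in>(\<Union>v\<in>C. {e. e \<subseteq> V \<and> ?clean e \<and> v \<in> e}). w e)"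
      using finV by (intro sum_mono2 finite_subset[of "\<Union>v\<in>C. _ v" "Pow V"]) (auto simp: w_nonneg)
    also have "\<dots> \<le> (\<Sum>v\<in>C. \<Sum>e | e \<subseteq> V \<and> ?clean e \<and> v \<in> e. w e)"
      using finV CV by (intro sum_UN_le) (auto simp: w_nonneg intro: finite_subset)
    also have "\<dots> \<le> (\<Sum>v\<in>C. 1 / (4 * M))"
    proof (rule sum_mono)
      fix v assume v: "v \<in> C"
      \<comment> \<open>Cleanness passes to subsets, so \<open>e - {v}\<close> is clean and the link
        of \<open>v\<close> retains the full weight of \<open>e\<close>.\<close>
      have "(\<Sum>e | e \<subseteq> V \<and> ?clean e \<and> v \<in> e. w e)
          \<le> (\<Sum>e | e \<subseteq> V \<and> ?clean e \<and> v \<in> e. link (build S) v (e - {v}))"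
        using v CV by (intro sum_mono) (auto simp: link_def clean_def insert_absorb)
      also have "\<dots> = sum (link (build S) v) ((\<lambda>e. e - {v}) ` {e. e \<subseteq> V \<and> ?clean e \<and> v \<in> e})"
      proof (subst sum.reindex)
        show "inj_on (\<lambda>e. e - {v}) {e. e \<subseteq> V \<and> ?clean e \<and> v \<in> e}"
          by (rule inj_onI) (metis (no_types, lifting) insert_Diff mem_Collect_eq)
      qed simp
      also have "\<dots> \<le> avail (build S) v"
        unfolding avail_def using finV by (intro sum_mono2) (auto simp: link_nonneg)
      also have "\<dots> \<le> 1 / (4 * M)" using v by (simp add: C_def cont_def)
      finally show "(\<Sum>e | e \<subseteq> V \<and> ?clean e \<and> v \<in> e. w e) \<le> 1 / (4 * M)" .
    qed
    also have "\<dots> = card C / (4 * M)" by simp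
    also have "\<dots> \<le> 1 / 4"
      using card_mono[OF finV CV] VM Mp by (simp add: field_simps)
    finally show ?thesis .
  qed
  have avoid: "(\<Sum>e | e \<subseteq> V \<and> ?clean e \<and> e \<inter> C = {}. w e) \<le> card (V - C) * (K / M)"
  proof -
    have "(\<Sum>e | e \<subseteq> V \<and> ?clean e \<and> e \<inter> C = {}. w e)
        \<le> (\<Sum>e\<in>(\<Union>v\<in>V - C. {e. e \<subseteq> V \<and> {v} \<subseteq> e}) . w e)"
    proof (rule sum_le_sum_superset)
      fix e assume "e \<in> {e. e \<subseteq> V \<and> ?clean e \<and> e \<inter> C = {}}"
        and "e \<notin> (\<Union>v\<in>V - C. {e. e \<subseteq> V \<and> {v} \<subseteq> e})"
      then have "e = {}" by auto
      then show "w e = 0" using w_unif[of "{}"] by auto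
    qed (use finV in \<open>auto simp: w_nonneg\<close>)
    also have "\<dots> \<le> (\<Sum>v\<in>V - C. wdeg V w {v})"
      unfolding wdeg_def using finV by (intro sum_UN_le) (auto simp: w_nonneg)
    also have "\<dots> \<le> (\<Sum>v\<in>V - C. K / M)"
      using w_deg[of "{v}" for v] by (intro sum_mono) force
    finally show ?thesis by simp
  qed
  have "1 \<le> sum w (Pow V)" by (rule w_total)
  also have "Pow V = {e. e \<subseteq> V \<and> \<not> ?clean e} \<union> ({e. e \<subseteq> V \<and> ?clean e \<and> e \<inter> C \<noteq> {}}
       \<union> {e. e \<subseteq> V \<and> ?clean e \<and> e \<inter> C = {}})" by auto
  also have "sum w \<dots> = (\<Sum>e | e \<subseteq> V \<and> \<not> ?clean e. w e) + ((\<Sum>e | e \<subseteq> V \<and> ?clean e \<and> e \<inter> C \<noteq> {}. w e)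
       + (\<Sum>e | e \<subseteq> V \<and> ?clean e \<and> e \<inter> C = {}. w e))"
    using finV by (subst sum.union_disjoint; auto intro!: sum.union_disjoint)+
  also have "\<dots> \<le> 1 / 4 + (1 / 4 + card (V - C) * (K / M))"
    using dirty_weight_le[OF S len] cleanC avoid by linarith
  finally show ?thesis using K Mp by (simp add: C_def field_simps)
qed


text \<open>The factor 4 M / m lifts the guaranteed total m / (4 M) to 1. It costs a factor 4 and
  one power of q in the degree bounds, which is exactly the shift from \<open>card T\<close> to
  \<open>card T - 1\<close>.\<close>

lemma spread_build:
  assumes S: "good_seq S" and len: "length S = m"
  shows "spread V (\<lambda>e. 4 * M / m * build S e) l q M (4 * (\<sigma> + K))"
proof -
  have Mp: "real M > 0" and mp: "real m > 0"
    using M_pos m_bounds by auto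
  have SV: "set S \<subseteq> V" using S by (rule good_seq_subset)
  have deg: "wdeg V (\<lambda>e. 4 * M / m * build S e) T \<le> 4 * (\<sigma> + K) * q ^ (card T - 1) / M"
    if T: "T \<subseteq> V" "T \<noteq> {}" for T
  proof -
    have "card T \<noteq> 0" using T finV by (auto simp: finite_subset)
    then have qT: "q ^ card T = q * q ^ (card T - 1)" by (cases "card T") auto
    have "wdeg V (\<lambda>e. 4 * M / m * build S e) T \<le> 4 * M / m * ((\<sigma> + K) * q ^ card T / M)"
      unfolding wdeg_scale using wdeg_build_le[OF SV T] by (intro mult_left_mono) auto
    also have "\<dots> = (q * M / m) * (4 * (\<sigma> + K) * q ^ (card T - 1) / M)"
      using Mp mp by (simp add: qT field_simps)
    \<comment> \<open>The number of rounds \<open>m\<close> is at least q M.\<close>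
    also have "\<dots> \<le> 1 * (4 * (\<sigma> + K) * q ^ (card T - 1) / M)"
      using m_bounds mp q K by (intro mult_right_mono) (auto simp: \<sigma>_def)
    finally show ?thesis by simp
  qed
  have "1 = 4 * M / m * (real (length S) / (4 * M))"
    using Mp mp by (simp add: len)
  also have "\<dots> \<le> 4 * M / m * sum (build S) (Pow V)"
    using total_build_ge[OF S] by (intro mult_left_mono) auto
  finally show ?thesis
    unfolding spread_def using finV deg build_supp build_nonneg
    by (auto 0 3 simp: sum_distrib_left dest!: build_supp)
qed

text \<open>Maximality replaces a run of the greedy algorithm: if a longest admissible list is
  shorter than \<open>m\<close>, no vertex of \<open>I\<close> can be put in front of it, so every
  vertex of \<open>I\<close> has a small link.\<close>

lemma indep_in_cont_or_long:
  assumes I: "I \<subseteq> V"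
  shows "\<exists>S. good_seq S \<and> set S \<subseteq> I \<and> length S \<le> m \<and> (length S = m \<or> I \<subseteq> cont S)"
proof -
  let ?P = "\<lambda>S. good_seq S \<and> set S \<subseteq> I \<and> length S \<le> m"
  have "?P []" by simp
  moreover have "\<forall>S. ?P S \<longrightarrow> length S < Suc m" by auto
  ultimately obtain S where S: "?P S" and max: "\<And>S'. ?P S' \<Longrightarrow> length S' \<le> length S"
    using ex_has_greatest_nat[of ?P "[]" length "Suc m"] by blast
  have "I \<subseteq> cont S" if "length S \<noteq> m"
  proof
    fix v assume v: "v \<in> I"
    show "v \<in> cont S"
    proof (rule ccontr)
      assume "v \<notin> cont S"
      then have "?P (v # S)" using v I S that by (auto simp: cont_def not_less)
      then show False using max[of "v # S"] by simp
    qed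
  qed
  then show ?thesis using S by blast
qed

end

lemma card_lists_length_at_most:
  assumes "finite A" and "card A \<le> M"
  shows "card {xs. set xs \<subseteq> A \<and> length xs \<le> m} \<le> (M + 1) ^ m"
proof (induction m)
  case (Suc m)
  let ?L = "\<lambda>m. {xs. set xs \<subseteq> A \<and> length xs \<le> m}"
  have "?L (Suc m) \<subseteq> insert [] ((\<lambda>(x, xs). x # xs) ` (A \<times> ?L m))"
  proof
    fix xs assume "xs \<in> ?L (Suc m)"
    then show "xs \<in> insert [] ((\<lambda>(x, xs). x # xs) ` (A \<times> ?L m))"
      by (cases xs) auto
  qed
  moreover have fin: "finite (?L m)" using finite_lists_length_le[OF assms(1)] .
  ultimately have "card (?L (Suc m)) \<le> card (insert [] ((\<lambda>(x, xs). x # xs) ` (A \<times> ?L m)))"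
    using assms(1) by (intro card_mono) auto
  also have "\<dots> \<le> 1 + card ((\<lambda>(x, xs). x # xs) ` (A \<times> ?L m))"
    using fin assms(1) by (simp add: card_insert_if)
  also have "\<dots> \<le> 1 + card A * card (?L m)"
    using fin assms(1) card_image_le[of "A \<times> ?L m"] by (simp add: card_cartesian_product)
  also have "\<dots> \<le> 1 + M * (M + 1) ^ m"
    using Suc assms(2) by (simp add: mult_le_mono)
  also have "\<dots> \<le> (M + 1) ^ Suc m" by simp
  finally show ?case .
next
  case 0
  have "{xs. set xs \<subseteq> A \<and> length xs \<le> 0} = {[]}" by auto
  then show ?case by simp
qed

text \<open>
  The containers are not tied to fingerprints inside the independent set: since the density used
  later exceeds the Ramsey threshold by a power of \<open>n\<close>, the number of containers is all that counts.
\<close>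

theorem hypergraph_container:
  fixes K :: real
  assumes "1 \<le> l" "1 \<le> K"
  shows "\<exists>c>0::real. \<forall>V (w :: 'v set \<Rightarrow> real) q M. spread V w l q M K \<longrightarrow> 0 < q \<longrightarrow> 1 \<le> q * M \<longrightarrow>
    card V \<le> M \<longrightarrow> (\<exists>\<C>. finite \<C> \<and> card \<C> \<le> (M + 1) ^ (l * (nat \<lceil>q * M\<rceil> + 1)) \<and>
      (\<forall>C\<in>\<C>. C \<subseteq> V \<and> c * real M \<le> real (card (V - C))) \<and> (\<forall>I\<subseteq>V. w_indep w I \<longrightarrow> (\<exists>C\<in>\<C>. I \<subseteq> C)))"
  using assms
proof (induction l arbitrary: K rule: nat_induct_at_least)
  case (base K)
  show ?case
  proof (intro exI[of _ "1 / K"] conjI allI impI)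
    show "0 < 1 / K" using base by simp
    fix V and w :: "'v set \<Rightarrow> real" and q M
    assume sp: "spread V w 1 q M K" and q: "0 < q" and qM: "1 \<le> q * real M"
    \<comment> \<open>With edges of size 1, an independent set avoids every vertex of positive
      weight, so a single container is enough.\<close>
    define C where "C = {v \<in> V. w {v} = 0}"
    have fin: "finite V" and supp: "\<And>e. w e \<noteq> 0 \<Longrightarrow> e \<subseteq> V \<and> card e = 1"
      and nn: "\<And>e. 0 \<le> w e" and tot: "1 \<le> sum w (Pow V)"
      and deg: "\<And>T. T \<subseteq> V \<Longrightarrow> T \<noteq> {} \<Longrightarrow> wdeg V w T \<le> K * q ^ (card T - 1) / M"
      using sp by (auto simp: spread_def)
    have Mp: "real M > 0" using qM by (cases M) auto
    have "1 \<le> sum w (Pow V)" by (rule tot)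
    also have "\<dots> \<le> sum w ((\<lambda>v. {v}) ` (V - C))"
    proof (rule sum_le_sum_superset)
      fix e assume e: "e \<in> Pow V" "e \<notin> (\<lambda>v. {v}) ` (V - C)"
      show "w e = 0"
      proof (rule ccontr)
        assume "w e \<noteq> 0"
        with supp[OF this] obtain v where "e = {v}" by (auto simp: card_1_singleton_iff)
        with e \<open>w e \<noteq> 0\<close> show False by (auto simp: C_def)
      qed
    qed (use fin nn in auto)
    also have "\<dots> = (\<Sum>v\<in>V - C. w {v})"
      by (subst sum.reindex) (auto simp: inj_on_def)
    also have "\<dots> \<le> (\<Sum>v\<in>V - C. K / M)"
    proof (rule sum_mono)
      fix v assume v: "v \<in> V - C"
      have "w {v} \<le> wdeg V w {v}"
        unfolding wdeg_def using fin nn v by (intro member_le_sum) auto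
      also have "\<dots> \<le> K / M" using deg[of "{v}"] v by auto
      finally show "w {v} \<le> K / M" .
    qed
    finally have "1 / K * real M \<le> real (card (V - C))"
      using base Mp by (simp add: field_simps)
    moreover have "I \<subseteq> C" if "I \<subseteq> V" "w_indep w I" for I
      using that by (auto simp: C_def w_indep_def)
    moreover have "1 \<le> (M + 1) ^ (1 * (nat \<lceil>q * M\<rceil> + 1))"
      by (rule one_le_power) simp
    moreover have "C \<subseteq> V" by (auto simp: C_def)
    ultimately show "\<exists>\<C>. finite \<C> \<and> card \<C> \<le> (M + 1) ^ (1 * (nat \<lceil>q * M\<rceil> + 1)) \<and>
      (\<forall>C\<in>\<C>. C \<subseteq> V \<and> 1 / K * real M \<le> real (card (V - C))) \<and> (\<forall>I\<subseteq>V. w_indep w I \<longrightarrow> (\<exists>C\<in>\<C>. I \<subseteq> C))"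
      by (intro exI[of _ "{C}"]) (auto simp del: power_Suc)
  qed
next
  case (Suc l K)
  \<comment> \<open>This is the value of \<open>\<sigma>\<close> in the coming round. It depends
    only on \<open>l\<close> and \<open>K\<close>, so the induction hypothesis yields its constant
    before \<open>V\<close>, \<open>w\<close>, \<open>q\<close> and \<open>M\<close> are
    fixed.\<close>
  define s where "s = 2 ^ (l + 3) * K\<^sup>2"
  have "1 \<le> 4 * (s + K)" using Suc.prems by (simp add: s_def add_increasing)
  from Suc.IH[OF this] obtain c :: real where c: "c > 0" and
    IH: "\<And>V (w :: 'v set \<Rightarrow> real) q M. spread V w l q M (4 * (s + K)) \<Longrightarrow> 0 < q \<Longrightarrow> 1 \<le> q * M \<Longrightarrow>
    card V \<le> M \<Longrightarrow> (\<exists>\<C>. finite \<C> \<and> card \<C> \<le> (M + 1) ^ (l * (nat \<lceil>q * M\<rceil> + 1)) \<and>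
      (\<forall>C\<in>\<C>. C \<subseteq> V \<and> c * real M \<le> real (card (V - C))) \<and> (\<forall>I\<subseteq>V. w_indep w I \<longrightarrow> (\<exists>C\<in>\<C>. I \<subseteq> C)))"
    by blast
  define c' where "c' = min c (1 / (2 * K))"
  show ?case
  proof (intro exI[of _ c'] conjI allI impI)
    show "0 < c'" using c Suc.prems by (simp add: c'_def)
    fix V and w :: "'v set \<Rightarrow> real" and q M
    assume sp: "spread V w (Suc l) q M K" and q: "0 < q" and qM: "1 \<le> q * real M"
      and VM: "card V \<le> M"
    interpret container_step V w l q M K
      using sp q qM Suc by unfold_locales auto
    have s_eq: "\<sigma> = s" by (simp add: \<sigma>_def s_def)
    let ?B = "(M + 1) ^ (l * (m + 1))"
    let ?w = "\<lambda>S e. 4 * M / m * build S e"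
    have c'c: "c' * M \<le> c * M" "c' * M \<le> real M / (2 * K)"
      using mult_right_mono[of c' c "real M"] mult_right_mono[of c' "1 / (2 * K)" "real M"]
      by (auto simp: c'_def)
    \<comment> \<open>Stated for every list, with the covering property only under a condition, so
      that a total choice function exists; other lists can receive the empty family.\<close>
    have "\<exists>\<C>. finite \<C> \<and> card \<C> \<le> ?B \<and> (\<forall>C\<in>\<C>. C \<subseteq> V \<and> c * real M \<le> real (card (V - C))) \<and>
        (good_seq S \<and> length S = m \<longrightarrow> (\<forall>I\<subseteq>V. w_indep (?w S) I \<longrightarrow> (\<exists>C\<in>\<C>. I \<subseteq> C)))" for S
    proof (cases "good_seq S \<and> length S = m")
      case True
      then have "spread V (?w S) l q M (4 * (s + K))"
        using spread_build[of S] by (simp add: s_eq)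
      from IH[OF this q qM VM] show ?thesis unfolding m_def by blast
    qed auto
    then obtain \<D> where \<D>: "\<And>S. finite (\<D> S)" "\<And>S. card (\<D> S) \<le> ?B"
        "\<And>S C. C \<in> \<D> S \<Longrightarrow> C \<subseteq> V \<and> c * real M \<le> real (card (V - C))"
        "\<And>S I. good_seq S \<Longrightarrow> length S = m \<Longrightarrow> I \<subseteq> V \<Longrightarrow> w_indep (?w S) I \<Longrightarrow> \<exists>C\<in>\<D> S. I \<subseteq> C"
      by metis
    let ?L = "{S. set S \<subseteq> V \<and> length S \<le> m}"
    \<comment> \<open>Short fingerprints are served by \<open>cont S\<close>, full ones by the
      containers of the rescaled hypergraph of smaller uniformity. The size bounds hold for every
      list in \<open>?L\<close>, good or not.\<close>
    define \<C> where "\<C> = (\<Union>S\<in>?L. insert (cont S) (\<D> S))"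
    have finL: "finite ?L" using finite_lists_length_le[OF finV] .
    have "card \<C> \<le> (\<Sum>S\<in>?L. card (insert (cont S) (\<D> S)))"
      unfolding \<C>_def using finL by (rule card_UN_le)
    also have "\<dots> \<le> (\<Sum>S\<in>?L. 1 + ?B)"
      using \<D>(1,2) by (intro sum_mono) (auto simp: card_insert_if intro: le_SucI)
    also have "\<dots> \<le> (M + 1) ^ m * (1 + ?B)"
      unfolding sum_constant of_nat_id
      by (rule mult_right_mono[OF card_lists_length_at_most[OF finV VM]]) simp
    \<comment> \<open>The extra factor M + 1 pays for \<open>cont S\<close>; it is the reason for
      the \<open>+ 1\<close> in the exponent.\<close>
    also have "\<dots> \<le> (M + 1) ^ m * ((M + 1) * ?B)"
      using M_pos by (intro mult_le_mono) auto
    also have "\<dots> = (M + 1) ^ (Suc l * (m + 1))"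
      by (simp add: power_add algebra_simps)
    finally have "card \<C> \<le> (M + 1) ^ (Suc l * (nat \<lceil>q * M\<rceil> + 1))" by (simp add: m_def)
    moreover have "finite \<C>" using finL \<D>(1) by (auto simp: \<C>_def)
    moreover have "C \<subseteq> V \<and> c' * real M \<le> real (card (V - C))" if "C \<in> \<C>" for C
      using that c'c \<D>(3) card_cont[OF _ _ VM] unfolding \<C>_def
      by (fastforce simp: cont_def)
    moreover have "\<exists>C\<in>\<C>. I \<subseteq> C" if I: "I \<subseteq> V" "w_indep w I" for I
    proof -
      from indep_in_cont_or_long[OF I(1)] obtain S where S: "good_seq S" "set S \<subseteq> I" "length S \<le> m"
        "length S = m \<or> I \<subseteq> cont S" by blast
      have SL: "S \<in> ?L" using S I by auto
      have "w_indep (?w S) I"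
        using w_indep_build[OF I(2) S(2)] by (simp add: w_indep_def)
      then show ?thesis using S SL \<D>(4)[OF S(1) _ I(1)] by (auto simp: \<C>_def)
    qed
    ultimately show "\<exists>\<C>. finite \<C> \<and> card \<C> \<le> (M + 1) ^ (Suc l * (nat \<lceil>q * M\<rceil> + 1)) \<and>
      (\<forall>C\<in>\<C>. C \<subseteq> V \<and> c' * real M \<le> real (card (V - C))) \<and> (\<forall>I\<subseteq>V. w_indep w I \<longrightarrow> (\<exists>C\<in>\<C>. I \<subseteq> C))"
      by blast
  qed
qed

section \<open>Containers for digraphs without a copy of a template\<close>

text \<open>Injective homomorphisms rather than subdigraphs: they are counted with automorphisms,
  and extensionality makes them finitely many.\<close>

definition emb :: "'a set \<Rightarrow> 'a rel \<Rightarrow> 'b set \<Rightarrow> 'b rel \<Rightarrow> ('a \<Rightarrow> 'b) set" where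
  "emb W A U C = {\<phi> \<in> W \<rightarrow>\<^sub>E U. inj_on \<phi> W \<and> (\<forall>(x, y)\<in>A. (\<phi> x, \<phi> y) \<in> C)}"

lemma finite_emb: "finite W \<Longrightarrow> finite U \<Longrightarrow> finite (emb W A U C)"
  unfolding emb_def by (rule finite_subset[of _ "W \<rightarrow>\<^sub>E U"]) (auto intro: finite_PiE)

lemma card_PiE_if:
  assumes "finite I" "J \<subseteq> I"
  shows "card (PiE I (\<lambda>i. if i \<in> J then X i else U)) = (\<Prod>i\<in>J. card (X i)) * card U ^ (card I - card J)"
proof -
  have "card (PiE I (\<lambda>i. if i \<in> J then X i else U)) = (\<Prod>i\<in>I. if i \<in> J then card (X i) else card U)"
    using assms(1) by (subst card_PiE) (auto intro: prod.cong)
  also have "\<dots> = (\<Prod>i\<in>J. card (X i)) * (\<Prod>i\<in>I - J. card U)"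
    using assms by (subst prod.If_cases) (auto simp: Int_absorb1 Diff_eq)
  finally show ?thesis using assms by (simp add: card_Diff_subset finite_subset)
qed

lemma card_PiE_prescribed:
  assumes "finite I" "J \<subseteq> I" "finite U"
  shows "card {\<psi> \<in> I \<rightarrow>\<^sub>E U. \<forall>i\<in>J. \<psi> i = g i} \<le> card U ^ (card I - card J)"
proof -
  have "card {\<psi> \<in> I \<rightarrow>\<^sub>E U. \<forall>i\<in>J. \<psi> i = g i} \<le> card (PiE I (\<lambda>i. if i \<in> J then {g i} else U))"
    using assms by (intro card_mono finite_PiE) (auto simp: PiE_def)
  then show ?thesis using card_PiE_if[OF assms(1,2), of "\<lambda>i. {g i}" U] by simp
qed

text \<open>\<open>dens\<close> is the 2-density bound for the subgraph spanned by the arc set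
  \<open>B\<close>. The multiplied form also covers two-vertex subgraphs, where it says that
  \<open>B\<close> is a single arc.\<close>

locale template =
  fixes W :: "'a set" and A :: "'a rel" and d :: real
  assumes finW: "finite W" and A_sub: "A \<subseteq> W \<times> W" and A_ne: "A \<noteq> {}"
    and d: "1 / 2 \<le> d"
    and dens: "\<And>B. B \<subseteq> A \<Longrightarrow> B \<noteq> {} \<Longrightarrow> 2 \<le> card (Field B) \<and> real (card B) - 1 \<le> d * (real (card (Field B)) - 2)"
begin

abbreviation k where "k \<equiv> card W"
abbreviation l where "l \<equiv> card A"

lemma finA: "finite A"
  using finW A_sub finite_subset by blast

lemma l_pos: "1 \<le> l"
  using finA A_ne by (simp add: Suc_leI card_gt_0_iff)

lemma Field_sub: "B \<subseteq> A \<Longrightarrow> Field B \<subseteq> W"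
  using A_sub by (auto simp: Field_def)

lemma inj_on_map_prod_arcs: "inj_on \<phi> W \<Longrightarrow> inj_on (map_prod \<phi> \<phi>) A"
  using A_sub by (intro inj_on_subset[OF map_prod_inj_on]) auto

text \<open>Such an embedding maps some \<open>B\<close> with |B| = |T| onto \<open>T\<close>. The
  vertices of \<open>Field B\<close> then have at most 2 l choices each and the remaining ones at
  most |U|, so the count is O(|U|^(k - v(B))) for each of the at most 2^l sets
  \<open>B\<close>.\<close>

lemma card_emb_through_le:
  fixes U :: "'b set"
  assumes U: "finite U" "U \<noteq> {}" and T: "T \<subseteq> U \<times> U" "T \<noteq> {}"
  defines "q \<equiv> real (card U) powr (- 1 / d)"
  shows "card {\<phi> \<in> emb W A U C. T \<subseteq> map_prod \<phi> \<phi> ` A} * (real (card U))\<^sup>2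
    \<le> 2 ^ l * real (2 * l) ^ k * (real (card U) ^ k * q ^ (card T - 1))"
proof -
  let ?u = "card U"
  have u: "1 \<le> ?u" using U by (simp add: Suc_leI card_gt_0_iff)
  define \<B> where "\<B> = {B. B \<subseteq> A \<and> card B = card T}"
  define P where "P B = PiE W (\<lambda>x. if x \<in> Field B then Field T else U)" for B
  have finT: "finite T" using T U finite_subset by blast
  have fin\<B>: "finite \<B>" using finA by (auto simp: \<B>_def)
  have finP: "finite (P B)" for B
    using finW U finT by (auto simp: P_def finite_Field intro!: finite_PiE split: if_splits)
  have FT: "Field T \<subseteq> U" using T by (auto simp: Field_def)
  have "{\<phi> \<in> emb W A U C. T \<subseteq> map_prod \<phi> \<phi> ` A} \<subseteq> (\<Union>B\<in>\<B>. P B)"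
  proof
    fix \<phi> assume "\<phi> \<in> {\<phi> \<in> emb W A U C. T \<subseteq> map_prod \<phi> \<phi> ` A}"
    then have \<phi>: "\<phi> \<in> W \<rightarrow>\<^sub>E U" "inj_on \<phi> W" "T \<subseteq> map_prod \<phi> \<phi> ` A"
      by (auto simp: emb_def)
    then obtain B where B: "B \<subseteq> A" "T = map_prod \<phi> \<phi> ` B"
      by (meson subset_image_iff)
    have "card T = card B"
      using B inj_on_map_prod_arcs[OF \<phi>(2)] by (simp add: card_image inj_on_subset)
    moreover have "\<phi> x \<in> Field T" if "x \<in> Field B" for x
      using that B by (force simp: Field_def)
    ultimately show "\<phi> \<in> (\<Union>B\<in>\<B>. P B)"
      using B \<phi> by (auto simp: \<B>_def P_def PiE_iff intro!: bexI[of _ B])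
  qed
  then have "card {\<phi> \<in> emb W A U C. T \<subseteq> map_prod \<phi> \<phi> ` A} \<le> card (\<Union>B\<in>\<B>. P B)"
    using fin\<B> finP by (intro card_mono) auto
  also have "\<dots> \<le> (\<Sum>B\<in>\<B>. card (P B))"
    using fin\<B> by (rule card_UN_le)
  finally have "real (card {\<phi> \<in> emb W A U C. T \<subseteq> map_prod \<phi> \<phi> ` A}) \<le> (\<Sum>B\<in>\<B>. real (card (P B)))"
    unfolding of_nat_sum[symmetric] of_nat_le_iff .
  then have "card {\<phi> \<in> emb W A U C. T \<subseteq> map_prod \<phi> \<phi> ` A} * (real ?u)\<^sup>2
      \<le> (\<Sum>B\<in>\<B>. card (P B) * (real ?u)\<^sup>2)"
    unfolding sum_distrib_right[symmetric] by (intro mult_right_mono) auto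
  also have "\<dots> \<le> (\<Sum>B\<in>\<B>. real (2 * l) ^ k * (real ?u ^ k * q ^ (card T - 1)))"
  proof (rule sum_mono)
    fix B assume "B \<in> \<B>"
    then have B: "B \<subseteq> A" "card B = card T" by (auto simp: \<B>_def)
    then have Bne: "B \<noteq> {}" using T finT by auto
    let ?v = "card (Field B)"
    have v: "2 \<le> ?v" "real (card B) - 1 \<le> d * (real ?v - 2)" using dens[OF B(1) Bne] by auto
    have vk: "?v \<le> k" using Field_sub[OF B(1)] finW by (rule card_mono[rotated])
    have cT: "card T \<noteq> 0" using T finT by auto
    have "card T \<le> l" using B finA card_mono by metis
    moreover have "card (Field T) \<le> 2 * card T"
    proof -
      have "card (Field T) \<le> card (fst ` T) + card (snd ` T)"
        unfolding Field_def Domain_fst Range_snd by (rule card_Un_le)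
      also have "\<dots> \<le> card T + card T" by (intro add_mono card_image_le finT)
      finally show ?thesis by simp
    qed
    ultimately have FTl: "card (Field T) \<le> 2 * l" by linarith
    have "card (P B) = card (Field T) ^ ?v * ?u ^ (k - ?v)"
      unfolding P_def by (subst card_PiE_if[OF finW Field_sub[OF B(1)]]) simp
    also have "\<dots> \<le> (2 * l) ^ k * ?u ^ (k - ?v)"
    proof (rule mult_right_mono)
      have "card (Field T) ^ ?v \<le> (2 * l) ^ ?v" using FTl by (rule power_mono) simp
      also have "\<dots> \<le> (2 * l) ^ k" using l_pos vk by (intro power_increasing) auto
      finally show "card (Field T) ^ ?v \<le> (2 * l) ^ k" .
    qed simp
    finally have "real (card (P B)) \<le> real (2 * l) ^ k * real ?u ^ (k - ?v)"
      unfolding of_nat_power[symmetric] of_nat_mult[symmetric] of_nat_le_iff .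
    then have "card (P B) * (real ?u)\<^sup>2 \<le> real (2 * l) ^ k * (real ?u ^ (k - ?v) * (real ?u)\<^sup>2)"
      unfolding mult.assoc[symmetric] by (rule mult_right_mono) simp
    also have "real ?u ^ (k - ?v) * (real ?u)\<^sup>2 \<le> real ?u ^ k * q ^ (card T - 1)"
    proof -
      have "real ?u ^ (k - ?v) * (real ?u)\<^sup>2 = real ?u powr (real k - real (?v - 2))"
      proof -
        have "real ?u ^ (k - ?v) * (real ?u)\<^sup>2 = real ?u ^ (k - ?v + 2)" by (simp only: power_add)
        also have "\<dots> = real ?u powr real (k - ?v + 2)" using u by (subst powr_realpow) auto
        also have "real (k - ?v + 2) = real k - real (?v - 2)" using v vk by simp
        finally show ?thesis .
      qed
      \<comment> \<open>The 2-density enters here: |T| - 1 = |B| - 1 <= d (v(B) - 2). This is why q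
        = |U|^(-1/d) is the right container parameter.\<close>
      also have "\<dots> \<le> real ?u powr (real k - real (card T - 1) / d)"
      proof (rule powr_mono)
        have "real (card T - 1) \<le> d * real (?v - 2)"
          using v B cT by (simp add: of_nat_diff)
        then show "real k - real (?v - 2) \<le> real k - real (card T - 1) / d"
          using d by (simp add: field_simps)
      qed (use u in simp)
      also have "\<dots> = real ?u powr real k * (real ?u powr (- 1 / d)) powr real (card T - 1)"
        unfolding powr_powr powr_add[symmetric] by simp
      also have "\<dots> = real ?u ^ k * q ^ (card T - 1)"
        using u by (simp add: powr_realpow q_def)
      finally show ?thesis .
    qed
    finally show "card (P B) * (real ?u)\<^sup>2 \<le> real (2 * l) ^ k * (real ?u ^ k * q ^ (card T - 1))"
      by (simp add: mult_left_mono)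
  qed
  also have "\<dots> \<le> 2 ^ l * (real (2 * l) ^ k * (real ?u ^ k * q ^ (card T - 1)))"
  proof -
    have "card \<B> \<le> card (Pow A)" unfolding \<B>_def using finA by (intro card_mono) auto
    then have "card \<B> \<le> 2 ^ l" using finA by (simp add: card_Pow)
    then have "real (card \<B>) \<le> 2 ^ l" by (metis of_nat_le_iff of_nat_numeral of_nat_power)
    then show ?thesis by (simp add: mult_right_mono q_def)
  qed
  finally show ?thesis by (simp add: mult.assoc)
qed

text \<open>The vertices of the hypergraph are the arcs in \<open>C\<close>, and the weight of an
  arc set is the proportion of embeddings with that image. Many embeddings make the proportions
  through any fixed \<open>T\<close> small enough for \<open>spread\<close>; a digraph without a
  copy is an independent set.\<close>

lemma container_step_emb:
  fixes \<delta> :: real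
  assumes \<delta>: "0 < \<delta>"
  shows "\<exists>c>0::real. \<forall>(U :: 'b set) C. finite U \<longrightarrow> U \<noteq> {} \<longrightarrow> C \<subseteq> U \<times> U \<longrightarrow>
    \<delta> * real (card U) ^ k \<le> card (emb W A U C) \<longrightarrow>
    (\<exists>\<C>. finite \<C> \<and>
      card \<C> \<le> ((card U)\<^sup>2 + 1) ^ (l * (nat \<lceil>real (card U) powr (2 - 1 / d)\<rceil> + 1)) \<and>
      (\<forall>C'\<in>\<C>. C' \<subseteq> C \<and> c * (real (card U))\<^sup>2 \<le> real (card (C - C'))) \<and>
      (\<forall>D\<subseteq>C. emb W A U D = {} \<longrightarrow> (\<exists>C'\<in>\<C>. D \<subseteq> C')))"
proof -
  \<comment> \<open>The constant of \<open>card_emb_through_le\<close> divided by the assumed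
    proportion \<open>\<delta>\<close> of embeddings.\<close>
  define K where "K = max 1 (2 ^ l * real (2 * l) ^ k / \<delta>)"
  have K1: "1 \<le> K" by (simp add: K_def)
  from hypergraph_container[OF l_pos K1, where 'v = "'b \<times> 'b"] obtain c :: real where c: "c > 0" and
    cont: "\<And>V (w :: ('b \<times> 'b) set \<Rightarrow> real) q M. spread V w l q M K \<Longrightarrow> 0 < q \<Longrightarrow> 1 \<le> q * M \<Longrightarrow>
    card V \<le> M \<Longrightarrow> (\<exists>\<C>. finite \<C> \<and> card \<C> \<le> (M + 1) ^ (l * (nat \<lceil>q * M\<rceil> + 1)) \<and>
      (\<forall>C\<in>\<C>. C \<subseteq> V \<and> c * real M \<le> real (card (V - C))) \<and> (\<forall>I\<subseteq>V. w_indep w I \<longrightarrow> (\<exists>C\<in>\<C>. I \<subseteq> C)))"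
    by blast
  show ?thesis
  proof (intro exI[of _ c] conjI allI impI c)
    fix U :: "'b set" and C
    assume U: "finite U" "U \<noteq> {}" and C: "C \<subseteq> U \<times> U"
      and many: "\<delta> * real (card U) ^ k \<le> card (emb W A U C)"
    let ?u = "card U"
    let ?E = "emb W A U C"
    let ?im = "\<lambda>\<phi>. map_prod \<phi> \<phi> ` A"
    have u: "1 \<le> ?u" using U by (simp add: Suc_leI card_gt_0_iff)
    have uk: "0 < \<delta> * real ?u ^ k" using \<delta> u by simp
    have Epos: "0 < real (card ?E)" using uk many by linarith
    have finE: "finite ?E" using finW U by (simp add: finite_emb)
    have finC: "finite C" using C U finite_subset by blast
    define q where "q = real ?u powr (- 1 / d)"
    define w where "w e = card {\<phi> \<in> ?E. ?im \<phi> = e} / real (card ?E)" for e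
    have sumw: "sum w X = card {\<phi> \<in> ?E. ?im \<phi> \<in> X} / real (card ?E)" if "finite X" for X
    proof -
      have "sum w X = (\<Sum>e\<in>X. card {\<phi> \<in> ?E. ?im \<phi> = e}) / real (card ?E)"
        unfolding w_def by (simp add: sum_divide_distrib)
      also have "(\<Sum>e\<in>X. card {\<phi> \<in> ?E. ?im \<phi> = e}) = card (\<Union>e\<in>X. {\<phi> \<in> ?E. ?im \<phi> = e})"
        using that finE by (intro card_UN_disjoint[symmetric]) auto
      also have "(\<Union>e\<in>X. {\<phi> \<in> ?E. ?im \<phi> = e}) = {\<phi> \<in> ?E. ?im \<phi> \<in> X}" by auto
      finally show ?thesis by simp
    qed
    have supp: "e \<subseteq> C \<and> card e = l" if "w e \<noteq> 0" for e
    proof -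
      from that have "{\<phi> \<in> ?E. ?im \<phi> = e} \<noteq> {}" unfolding w_def by (intro notI) simp
      then obtain \<phi> where \<phi>: "\<phi> \<in> ?E" "?im \<phi> = e" by blast
      then show ?thesis
        using card_image[OF inj_on_map_prod_arcs[of \<phi>]] by (auto simp: emb_def)
    qed
    have "spread C w l q (?u\<^sup>2) K"
      unfolding spread_def
    proof (intro conjI allI impI)
      show "1 \<le> sum w (Pow C)"
      proof -
        have "{\<phi> \<in> ?E. ?im \<phi> \<in> Pow C} = ?E" by (auto simp: emb_def)
        then show ?thesis using sumw[of "Pow C"] finC Epos by simp
      qed
      fix T assume T: "T \<subseteq> C" "T \<noteq> {}"
      have "wdeg C w T \<le> card {\<phi> \<in> ?E. T \<subseteq> ?im \<phi>} / real (card ?E)"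
        unfolding wdeg_def using finC finE
        by (subst sumw) (auto intro!: divide_right_mono card_mono)
      also have "\<dots> \<le> (2 ^ l * real (2 * l) ^ k * (real ?u ^ k * q ^ (card T - 1)) / (real ?u)\<^sup>2) / real (card ?E)"
        using card_emb_through_le[OF U _ T(2), of C] T C u
        by (intro divide_right_mono) (auto simp: pos_le_divide_eq q_def)
      also have "\<dots> \<le> (2 ^ l * real (2 * l) ^ k * (real ?u ^ k * q ^ (card T - 1)) / (real ?u)\<^sup>2) / (\<delta> * real ?u ^ k)"
        using many uk Epos by (intro divide_left_mono) (auto simp: q_def)
      also have "\<dots> = (2 ^ l * real (2 * l) ^ k / \<delta>) * q ^ (card T - 1) / real (?u\<^sup>2)"
        using u by (simp add: field_simps)
      also have "\<dots> \<le> K * q ^ (card T - 1) / real (?u\<^sup>2)"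
        by (intro divide_right_mono mult_right_mono) (auto simp: K_def q_def)
      finally show "wdeg C w T \<le> K * q ^ (card T - 1) / real (?u\<^sup>2)" .
    qed (use finC supp in \<open>auto simp: w_def\<close>)
    moreover have "0 < q" using u by (simp add: q_def)
    moreover have qM: "q * real (?u\<^sup>2) = real ?u powr (2 - 1 / d)"
    proof -
      have "(real ?u)\<^sup>2 = real ?u powr 2" using u by simp
      then show ?thesis unfolding q_def of_nat_power by (simp only: powr_add[symmetric]) simp
    qed
    \<comment> \<open>Since d >= 1/2, the exponent 2 - 1/d is nonnegative.\<close>
    moreover have "1 \<le> q * real (?u\<^sup>2)"
      unfolding qM using u d by (intro ge_one_powr_ge_zero) (auto simp: field_simps)
    moreover have "card C \<le> ?u\<^sup>2"
      using card_mono[OF _ C] U by (simp add: card_cartesian_product power2_eq_square)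
    ultimately obtain \<C> where \<C>: "finite \<C>"
      "card \<C> \<le> (?u\<^sup>2 + 1) ^ (l * (nat \<lceil>real ?u powr (2 - 1 / d)\<rceil> + 1))"
      "\<forall>C'\<in>\<C>. C' \<subseteq> C \<and> c * real (?u\<^sup>2) \<le> real (card (C - C'))"
      "\<forall>I\<subseteq>C. w_indep w I \<longrightarrow> (\<exists>C\<in>\<C>. I \<subseteq> C)"
      using cont[of C w q "?u\<^sup>2"] by metis
    have "w_indep w D" if D: "emb W A U D = {}" for D
      unfolding w_indep_def
    proof (intro allI impI)
      fix e assume e: "e \<subseteq> D"
      have "{\<phi> \<in> ?E. ?im \<phi> = e} \<subseteq> emb W A U D"
        using e unfolding emb_def by force
      then have "{\<phi> \<in> ?E. ?im \<phi> = e} = {}" using D by blast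
      then show "w e = 0" by (simp only: w_def card.empty of_nat_0 div_0)
    qed
    with \<C> show "\<exists>\<C>. finite \<C> \<and>
      card \<C> \<le> ((card U)\<^sup>2 + 1) ^ (l * (nat \<lceil>real (card U) powr (2 - 1 / d)\<rceil> + 1)) \<and>
      (\<forall>C'\<in>\<C>. C' \<subseteq> C \<and> c * (real (card U))\<^sup>2 \<le> real (card (C - C'))) \<and>
      (\<forall>D\<subseteq>C. emb W A U D = {} \<longrightarrow> (\<exists>C'\<in>\<C>. D \<subseteq> C'))"
      by (intro exI[of _ \<C>]) auto
  qed
qed

text \<open>Iteration: a container that still has many embeddings is refined, and each refinement
  loses at least c |U|^2 arcs. This can happen only a bounded number of times, so the count of
  containers is raised to a constant power only.\<close>

theorem emb_containers:
  fixes \<delta> :: real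
  assumes \<delta>: "0 < \<delta>"
  shows "\<exists>t::nat. \<forall>U :: 'b set. finite U \<longrightarrow> U \<noteq> {} \<longrightarrow>
    (\<exists>\<C>. finite \<C> \<and>
      card \<C> \<le> ((card U)\<^sup>2 + 1) ^ (t * (nat \<lceil>real (card U) powr (2 - 1 / d)\<rceil> + 1)) \<and>
      (\<forall>C\<in>\<C>. C \<subseteq> U \<times> U \<and> card (emb W A U C) < \<delta> * real (card U) ^ k) \<and>
      (\<forall>D\<subseteq>U \<times> U. emb W A U D = {} \<longrightarrow> (\<exists>C\<in>\<C>. D \<subseteq> C)))"
proof -
  from container_step_emb[OF \<delta>, where 'b = 'b] obtain c :: real where c: "c > 0" and
    step: "\<forall>(U :: 'b set) C. finite U \<longrightarrow> U \<noteq> {} \<longrightarrow> C \<subseteq> U \<times> U \<longrightarrow>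
    \<delta> * real (card U) ^ k \<le> card (emb W A U C) \<longrightarrow>
    (\<exists>\<C>. finite \<C> \<and>
      card \<C> \<le> ((card U)\<^sup>2 + 1) ^ (l * (nat \<lceil>real (card U) powr (2 - 1 / d)\<rceil> + 1)) \<and>
      (\<forall>C'\<in>\<C>. C' \<subseteq> C \<and> c * (real (card U))\<^sup>2 \<le> real (card (C - C'))) \<and>
      (\<forall>D\<subseteq>C. emb W A U D = {} \<longrightarrow> (\<exists>C'\<in>\<C>. D \<subseteq> C')))"
    by (elim exE conjE) (rule that)
  \<comment> \<open>More than 1 / c rounds would leave a negative number of arcs, so after
    \<open>i0\<close> rounds only the alternative \<open>?few\<close> remains.\<close>
  obtain i0 :: nat where i0: "1 < i0 * c" using reals_Archimedean3[OF c] by blast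
  show ?thesis
  proof (intro exI[of _ "l * i0"] allI impI)
    fix U :: "'b set"
    assume U: "finite U" "U \<noteq> {}"
    let ?u = "card U"
    let ?few = "\<lambda>C. real (card (emb W A U C)) < \<delta> * real ?u ^ k"
    define N where "N = nat \<lceil>real ?u powr (2 - 1 / d)\<rceil> + 1"
    define Bd where "Bd = (?u\<^sup>2 + 1) ^ (l * N)"
    have Bd: "1 \<le> Bd" by (simp add: Bd_def)
    have u: "1 \<le> ?u" using U by (simp add: Suc_leI card_gt_0_iff)
    have "\<exists>\<C>. finite \<C> \<and> card \<C> \<le> Bd ^ i \<and>
      (\<forall>C\<in>\<C>. C \<subseteq> U \<times> U \<and> (?few C \<or> real (card C) \<le> (1 - i * c) * (real ?u)\<^sup>2)) \<and>
      (\<forall>D\<subseteq>U \<times> U. emb W A U D = {} \<longrightarrow> (\<exists>C\<in>\<C>. D \<subseteq> C))" for i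
    proof (induction i)
      case 0
      show ?case
        using U by (intro exI[of _ "{U \<times> U}"]) (auto simp: card_cartesian_product power2_eq_square)
    next
      case (Suc i)
      then obtain \<C> where \<C>: "finite \<C>" "card \<C> \<le> Bd ^ i"
        "\<forall>C\<in>\<C>. C \<subseteq> U \<times> U \<and> (?few C \<or> real (card C) \<le> (1 - i * c) * (real ?u)\<^sup>2)"
        "\<forall>D\<subseteq>U \<times> U. emb W A U D = {} \<longrightarrow> (\<exists>C\<in>\<C>. D \<subseteq> C)"
        by (elim exE conjE) (rule that)
      have "\<forall>C\<in>\<C>. \<exists>\<D>. finite \<D> \<and> card \<D> \<le> Bd \<and>
          (\<forall>C'\<in>\<D>. C' \<subseteq> U \<times> U \<and> (?few C' \<or> real (card C') \<le> (1 - Suc i * c) * (real ?u)\<^sup>2)) \<and>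
          (\<forall>D\<subseteq>C. emb W A U D = {} \<longrightarrow> (\<exists>C'\<in>\<D>. D \<subseteq> C'))"
      proof
        fix C assume C0: "C \<in> \<C>"
        show "\<exists>\<D>. finite \<D> \<and> card \<D> \<le> Bd \<and>
            (\<forall>C'\<in>\<D>. C' \<subseteq> U \<times> U \<and> (?few C' \<or> real (card C') \<le> (1 - Suc i * c) * (real ?u)\<^sup>2)) \<and>
            (\<forall>D\<subseteq>C. emb W A U D = {} \<longrightarrow> (\<exists>C'\<in>\<D>. D \<subseteq> C'))"
        proof (cases "?few C")
          case False
          then have C: "C \<subseteq> U \<times> U" "real (card C) \<le> (1 - i * c) * (real ?u)\<^sup>2"
              "\<delta> * real ?u ^ k \<le> card (emb W A U C)"
            using bspec[OF \<C>(3) C0] by auto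
          from step[rule_format, OF U C(1,3), folded N_def, folded Bd_def] obtain \<D> where \<D>: "finite \<D>" "card \<D> \<le> Bd"
            "\<forall>C'\<in>\<D>. C' \<subseteq> C \<and> c * (real ?u)\<^sup>2 \<le> real (card (C - C'))"
            "\<forall>D\<subseteq>C. emb W A U D = {} \<longrightarrow> (\<exists>C'\<in>\<D>. D \<subseteq> C')"
            by (elim exE conjE) (rule that)
          have "real (card C') \<le> (1 - Suc i * c) * (real ?u)\<^sup>2" if "C' \<in> \<D>" for C'
          proof -
            have C': "C' \<subseteq> C" "c * (real ?u)\<^sup>2 \<le> real (card (C - C'))"
              using bspec[OF \<D>(3) that] by auto
            have "finite C" using C(1) U by (auto intro: finite_subset)
            with C' have "card C = card C' + card (C - C')"
              by (metis card_Diff_subset card_mono finite_subset le_add_diff_inverse)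
            then show ?thesis using C' C(2) by (simp add: algebra_simps)
          qed
          moreover have "C' \<subseteq> U \<times> U" if "C' \<in> \<D>" for C'
            using bspec[OF \<D>(3) that] C(1) by auto
          ultimately show ?thesis using \<D>(1,2,4) by (intro exI[of _ \<D>] impI conjI ballI) simp_all
        next
          case True
          then show ?thesis using bspec[OF \<C>(3) C0] Bd by (intro exI[of _ "{C}"]) auto
        qed
      qed
      from bchoice[OF this] obtain \<D> where \<D>: "\<forall>C\<in>\<C>. finite (\<D> C) \<and> card (\<D> C) \<le> Bd \<and>
          (\<forall>C'\<in>\<D> C. C' \<subseteq> U \<times> U \<and> (?few C' \<or> real (card C') \<le> (1 - Suc i * c) * (real ?u)\<^sup>2)) \<and>
          (\<forall>D\<subseteq>C. emb W A U D = {} \<longrightarrow> (\<exists>C'\<in>\<D> C. D \<subseteq> C'))"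
        by (elim exE) (rule that)
      have "card (\<Union>C\<in>\<C>. \<D> C) \<le> (\<Sum>C\<in>\<C>. card (\<D> C))" using \<C>(1) by (rule card_UN_le)
      also have "\<dots> \<le> (\<Sum>C\<in>\<C>. Bd)" using \<D> by (intro sum_mono) simp
      also have "\<dots> \<le> Bd ^ Suc i" using \<C>(2) by (simp add: mult.commute)
      finally have "card (\<Union>C\<in>\<C>. \<D> C) \<le> Bd ^ Suc i" .
      moreover have "\<exists>C'\<in>\<Union>C\<in>\<C>. \<D> C. D \<subseteq> C'" if D: "D \<subseteq> U \<times> U" "emb W A U D = {}" for D
      proof -
        obtain C where "C \<in> \<C>" "D \<subseteq> C" using \<C>(4) D by meson
        moreover from this obtain C' where "C' \<in> \<D> C" "D \<subseteq> C'" using \<D> D(2) by meson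
        ultimately show ?thesis by blast
      qed
      moreover have "C' \<subseteq> U \<times> U" "?few C' \<or> real (card C') \<le> (1 - Suc i * c) * (real ?u)\<^sup>2"
        if "C' \<in> (\<Union>C\<in>\<C>. \<D> C)" for C'
        using that \<D> by blast+
      moreover have "finite (\<Union>C\<in>\<C>. \<D> C)" using \<C>(1) \<D> by blast
      ultimately show ?case
        by (intro exI[of _ "\<Union>C\<in>\<C>. \<D> C"] conjI ballI allI impI)
    qed
    from this[of i0] obtain \<C> where \<C>: "finite \<C>" "card \<C> \<le> Bd ^ i0"
        "\<forall>C\<in>\<C>. C \<subseteq> U \<times> U \<and> (?few C \<or> real (card C) \<le> (1 - i0 * c) * (real ?u)\<^sup>2)"
        "\<forall>D\<subseteq>U \<times> U. emb W A U D = {} \<longrightarrow> (\<exists>C\<in>\<C>. D \<subseteq> C)"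
      by (elim exE conjE) (rule that)
    have "(1 - i0 * c) * (real ?u)\<^sup>2 < 0" using i0 u by (simp add: mult_neg_pos)
    then have "\<forall>C\<in>\<C>. C \<subseteq> U \<times> U \<and> ?few C"
      using \<C>(3) by (meson linorder_not_less of_nat_0_le_iff order_trans)
    moreover have "Bd ^ i0 = (?u\<^sup>2 + 1) ^ (l * i0 * N)"
      by (simp add: Bd_def power_mult[symmetric] algebra_simps)
    ultimately show "\<exists>\<C>. finite \<C> \<and>
      card \<C> \<le> (?u\<^sup>2 + 1) ^ (l * i0 * (nat \<lceil>real ?u powr (2 - 1 / d)\<rceil> + 1)) \<and>
      (\<forall>C\<in>\<C>. C \<subseteq> U \<times> U \<and> ?few C) \<and>
      (\<forall>D\<subseteq>U \<times> U. emb W A U D = {} \<longrightarrow> (\<exists>C\<in>\<C>. D \<subseteq> C))"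
      using \<C>(1,2,4) by (intro exI[of _ \<C>] conjI) (simp_all add: N_def)
  qed
qed

end

section \<open>Supersaturation\<close>

text \<open>Any vertex has at least 2^k out-neighbours or at least 2^k in-neighbours among the other
  2^(k+1) - 1 vertices; it goes in front of, or behind, a chain found there. Pairs may be joined
  both ways, so the lemma applies to containers as well as to orientations.\<close>

lemma tournament_chain:
  assumes "finite S" "2 ^ k \<le> card S"
    and "\<And>x y. x \<in> S \<Longrightarrow> y \<in> S \<Longrightarrow> x \<noteq> y \<Longrightarrow> (x, y) \<in> C \<or> (y, x) \<in> C"
  shows "\<exists>xs. length xs = Suc k \<and> distinct xs \<and> set xs \<subseteq> S \<and> sorted_wrt (\<lambda>x y. (x, y) \<in> C) xs"
  using assms
proof (induction k arbitrary: S)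
  case 0
  then obtain v where "v \<in> S" by (metis all_not_in_conv card.empty not_one_le_zero power_0)
  then show ?case by (intro exI[of _ "[v]"]) simp
next
  case (Suc k)
  from Suc.prems(2) have "card S \<noteq> 0" using zero_less_power[of "2::nat" "Suc k"] by linarith
  then obtain v where v: "v \<in> S" by fastforce
  define Out where "Out = {x \<in> S - {v}. (v, x) \<in> C}"
  define In where "In = {x \<in> S - {v}. (x, v) \<in> C}"
  have "S - {v} \<subseteq> Out \<union> In" using Suc.prems(3) v by (auto simp: Out_def In_def)
  then have "card (S - {v}) \<le> card (Out \<union> In)"
    using Suc.prems(1) by (intro card_mono) (auto simp: Out_def In_def)
  also have "\<dots> \<le> card Out + card In" by (rule card_Un_le)
  finally have "2 ^ Suc k \<le> Suc (card Out + card In)" using Suc.prems v by simp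
  \<comment> \<open>If both neighbourhoods were smaller than 2^k, the right-hand side would be at
    most 2^(k+1) - 1.\<close>
  then consider "2 ^ k \<le> card Out" | "2 ^ k \<le> card In" by fastforce
  then show ?case
  proof cases
    case 1
    have "finite Out" using Suc.prems(1) by (simp add: Out_def)
    from Suc.IH[OF this 1] obtain xs where "length xs = Suc k" "distinct xs" "set xs \<subseteq> Out"
      "sorted_wrt (\<lambda>x y. (x, y) \<in> C) xs"
      using Suc.prems(3) by (auto simp: Out_def)
    then show ?thesis using v by (intro exI[of _ "v # xs"]) (auto simp: Out_def)
  next
    case 2
    have "finite In" using Suc.prems(1) by (simp add: In_def)
    from Suc.IH[OF this 2] obtain xs where "length xs = Suc k" "distinct xs" "set xs \<subseteq> In"
      "sorted_wrt (\<lambda>x y. (x, y) \<in> C) xs"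
      using Suc.prems(3) by (auto simp: In_def)
    then show ?thesis using v by (intro exI[of _ "xs @ [v]"]) (auto simp: In_def sorted_wrt_append)
  qed
qed

text \<open>A topological order, obtained by repeatedly removing a source.\<close>

lemma finite_acyclic_topological_list:
  assumes "finite W" "acyclic A"
  shows "\<exists>xs. distinct xs \<and> set xs = W \<and> sorted_wrt (\<lambda>x y. (y, x) \<notin> A) xs"
  using assms(1)
proof (induction W rule: finite_psubset_induct)
  case (psubset W)
  show ?case
  proof (cases "W = {}")
    case False
    have "wf (A \<inter> W \<times> W)"
      using psubset.hyps assms(2) by (intro finite_acyclic_wf) (auto intro: acyclic_subset)
    then obtain z where z: "z \<in> W" "\<And>y. (y, z) \<in> A \<inter> W \<times> W \<Longrightarrow> y \<notin> W"
      using False by (metis wfE_min all_not_in_conv)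
    obtain xs where "distinct xs" "set xs = W - {z}" "sorted_wrt (\<lambda>x y. (y, x) \<notin> A) xs"
      using psubset.IH[of "W - {z}"] z(1) by blast
    moreover have "\<forall>y\<in>W. (y, z) \<notin> A" using z by blast
    ultimately show ?thesis using z(1) by (intro exI[of _ "z # xs"]) (simp add: insert_absorb)
  qed simp
qed

lemma finite_acyclic_rank:
  assumes "finite W" "acyclic A" "A \<subseteq> W \<times> W"
  shows "\<exists>\<tau> :: 'a \<Rightarrow> nat. inj_on \<tau> W \<and> \<tau> ` W \<subseteq> {..<card W} \<and> (\<forall>(x, y)\<in>A. \<tau> x < \<tau> y)"
proof -
  obtain xs where xs: "distinct xs" "set xs = W" "sorted_wrt (\<lambda>x y. (y, x) \<notin> A) xs"
    using finite_acyclic_topological_list[OF assms(1,2)] by blast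
  have len: "length xs = card W" using xs distinct_card by metis
  have "\<exists>i<length xs. xs ! i = x" if "x \<in> W" for x using that xs by (metis in_set_conv_nth)
  then obtain \<tau> where \<tau>: "\<And>x. x \<in> W \<Longrightarrow> \<tau> x < length xs \<and> xs ! \<tau> x = x" by metis
  have "\<tau> x < \<tau> y" if xy: "(x, y) \<in> A" for x y
  proof (rule ccontr)
    assume "\<not> \<tau> x < \<tau> y"
    moreover have W: "x \<in> W" "y \<in> W" using xy assms(3) by auto
    moreover have "x \<noteq> y" using xy assms(2) by (auto simp: acyclic_def)
    ultimately have "\<tau> y < \<tau> x" using \<tau> by (metis nat_neq_iff)
    then show False using sorted_wrt_nth_less[OF xs(3)] \<tau> W xy by metis
  qed
  moreover have "inj_on \<tau> W" by (rule inj_onI) (metis \<tau>)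
  ultimately show ?thesis using \<tau> len by (intro exI[of _ \<tau>]) auto
qed

section \<open>Digraphs with few copies miss many pairs\<close>

definition missing :: "'b set \<Rightarrow> 'b rel \<Rightarrow> 'b set set" where
  "missing U C = {{x, y} | x y. x \<in> U \<and> y \<in> U \<and> x \<noteq> y \<and> (x, y) \<notin> C \<and> (y, x) \<notin> C}"

lemma finite_missing: "finite U \<Longrightarrow> finite (missing U C)"
  by (rule finite_subset[of _ "Pow U"]) (auto simp: missing_def)

lemma missing_mono: "D \<subseteq> C \<Longrightarrow> missing U C \<subseteq> missing U D"
  by (force simp: missing_def)

locale acyclic_template = template +
  assumes acyc: "acyclic A"
begin

lemma k_pos: "1 \<le> k"
  using A_ne A_sub finW by (auto simp: Suc_le_eq card_gt_0_iff)

text \<open>The sample size at which \<open>tournament_chain\<close> provides a chain long enough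
  for all \<open>k\<close> vertices of the template.\<close>

definition R :: nat where "R = 2 ^ k"

lemma R_bounds: "k \<le> R" "2 \<le> R"
  using k_pos power_increasing[of 1 k "2::nat"] unfolding R_def by (auto intro: less_imp_le)

text \<open>The entries of the tuple span a semicomplete digraph, which has a transitive chain; an
  acyclic template fits along it in topological order. The map \<open>h\<close> records which
  coordinates carry the copy, as the counting of tuples requires.\<close>

lemma copy_in_tuple:
  assumes \<psi>: "\<psi> \<in> {..<R} \<rightarrow>\<^sub>E U"
    and full: "\<And>i j. i < j \<Longrightarrow> j < R \<Longrightarrow> \<psi> i \<noteq> \<psi> j \<and> ((\<psi> i, \<psi> j) \<in> C \<or> (\<psi> j, \<psi> i) \<in> C)"
  shows "\<exists>\<phi>\<in>emb W A U C. \<exists>h\<in>W \<rightarrow>\<^sub>E {..<R}. inj_on h W \<and> (\<forall>x\<in>W. \<psi> (h x) = \<phi> x)"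
proof -
  have full': "\<psi> i \<noteq> \<psi> j \<and> ((\<psi> i, \<psi> j) \<in> C \<or> (\<psi> j, \<psi> i) \<in> C)" if "i < R" "j < R" "i \<noteq> j" for i j
    using that full[of i j] full[of j i] by (cases i j rule: linorder_cases) metis+
  obtain \<tau> where \<tau>: "inj_on \<tau> W" "\<tau> ` W \<subseteq> {..<k}" "\<forall>(x, y)\<in>A. \<tau> x < \<tau> y"
    using finite_acyclic_rank[OF finW acyc A_sub] by blast
  obtain xs where xs: "length xs = Suc k" "distinct xs" "set xs \<subseteq> {..<R}"
    "sorted_wrt (\<lambda>x y. (x, y) \<in> {(i, j). (\<psi> i, \<psi> j) \<in> C}) xs"
    using tournament_chain[of "{..<R}" k "{(i, j). (\<psi> i, \<psi> j) \<in> C}"] full' by (auto simp: R_def)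
  define h where "h = (\<lambda>x\<in>W. xs ! \<tau> x)"
  define \<phi> where "\<phi> = (\<lambda>x\<in>W. \<psi> (h x))"
  have \<tau>k: "\<tau> x < k" if "x \<in> W" for x using \<tau>(2) that by auto
  have h: "h \<in> W \<rightarrow>\<^sub>E {..<R}"
  proof -
    have "xs ! i < R" if "i < Suc k" for i using xs(1,3) that nth_mem[of i xs]
      by (metis lessThan_iff subsetD)
    then show ?thesis using \<tau>k by (auto simp: h_def less_SucI)
  qed
  have inj_h: "inj_on h W"
  proof (rule inj_onI)
    fix x y assume "x \<in> W" "y \<in> W" "h x = h y"
    then have "\<tau> x = \<tau> y"
      using xs(1,2) \<tau>k by (simp add: h_def nth_eq_iff_index_eq less_SucI)
    then show "x = y" using \<tau>(1) \<open>x \<in> W\<close> \<open>y \<in> W\<close> by (simp add: inj_on_eq_iff)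
  qed
  have hR: "h x < R" if "x \<in> W" for x using h that by auto
  have "inj_on \<phi> W"
  proof (rule inj_onI)
    fix x y assume xy: "x \<in> W" "y \<in> W" "\<phi> x = \<phi> y"
    then have "h x = h y" using full'[of "h x" "h y"] hR by (auto simp: \<phi>_def)
    then show "x = y" using inj_h xy by (simp add: inj_on_eq_iff)
  qed
  moreover have "(\<phi> x, \<phi> y) \<in> C" if xy: "(x, y) \<in> A" for x y
  proof -
    have W: "x \<in> W" "y \<in> W" using xy A_sub by auto
    then show ?thesis
      using sorted_wrt_nth_less[OF xs(4), of "\<tau> x" "\<tau> y"] \<tau>(3) xy \<tau>k xs(1)
      by (auto simp: \<phi>_def h_def less_SucI)
  qed
  moreover have "\<phi> \<in> W \<rightarrow>\<^sub>E U" using \<psi> h by (auto simp: \<phi>_def PiE_iff)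
  ultimately have "\<phi> \<in> emb W A U C" by (auto simp: emb_def)
  then show ?thesis using h inj_h by (intro bexI[of _ \<phi>] bexI[of _ h]) (auto simp: \<phi>_def)
qed

text \<open>Supersaturation by sampling: each of the |U|^R tuples contains an embedding at some
  positions \<open>h\<close> or a pair from \<open>Z\<close> at some positions i < j. With few
  embeddings the first kind makes up at most half of all tuples, so |Z| >= |U|^2 / (2 R^2).\<close>

lemma few_copies_imp_missing:
  assumes U: "finite U" "4 * R\<^sup>2 \<le> card U"
    and few: "real (card (emb W A U C)) < 1 / (2 * R ^ k) * real (card U) ^ k"
  shows "1 / (16 * R\<^sup>2) * (real (card U))\<^sup>2 \<le> real (card (missing U C))"
proof -
  let ?u = "card U"
  have Rp: "0 < R" using R_bounds by simp
  have u: "0 < ?u" using U R_bounds by (cases "card U") auto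
  define Z where "Z = {(x, y) \<in> U \<times> U. x = y \<or> (x, y) \<notin> C \<and> (y, x) \<notin> C}"
  have finZ: "finite Z" using U by (auto simp: Z_def intro: finite_subset[of _ "U \<times> U"])
  define T where "T = ({..<R} \<rightarrow>\<^sub>E U)"
  have finT: "finite T" using U by (simp add: T_def finite_PiE)
  define H where "H = {h \<in> W \<rightarrow>\<^sub>E {..<R}. inj_on h W}"
  define E where "E = emb W A U C"
  have finE: "finite E" using finW U by (simp add: E_def finite_emb)
  have finH: "finite H" unfolding H_def using finW by (intro finite_subset[OF _ finite_PiE[of W "\<lambda>_. {..<R}"]]) auto
  \<comment> \<open>Tuples that carry \<open>\<phi>\<close> at the coordinates given by
    \<open>h\<close>; \<open>inv_into W h t\<close> is the template vertex placed at coordinate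
    \<open>t\<close>.\<close>
  define P where "P = (\<lambda>(\<phi>, h). {\<psi> \<in> T. \<forall>t\<in>h ` W. \<psi> t = \<phi> (inv_into W h t)})"
  define Q where "Q = (\<lambda>((i, j), (a, b)). {\<psi> \<in> T. \<forall>t\<in>{i, j}. \<psi> t = (if t = i then a else b)})"
  define J where "J = {(i, j). i < j \<and> j < R}"
  have J: "finite J" "card J \<le> R\<^sup>2"
  proof -
    have "J \<subseteq> {..<R} \<times> {..<R}" by (auto simp: J_def)
    then show "finite J" "card J \<le> R\<^sup>2"
      using card_mono[of "{..<R} \<times> {..<R}" J]
      by (auto simp: card_cartesian_product power2_eq_square intro: finite_subset)
  qed
  have cover: "T \<subseteq> (\<Union>x\<in>E \<times> H. P x) \<union> (\<Union>x\<in>J \<times> Z. Q x)"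
  proof
    fix \<psi> assume \<psi>: "\<psi> \<in> T"
    show "\<psi> \<in> (\<Union>x\<in>E \<times> H. P x) \<union> (\<Union>x\<in>J \<times> Z. Q x)"
    proof (cases "\<exists>i j. i < j \<and> j < R \<and> (\<psi> i, \<psi> j) \<in> Z")
      case True
      then obtain i j where "(i, j) \<in> J" "(\<psi> i, \<psi> j) \<in> Z" by (auto simp: J_def)
      then show ?thesis using \<psi> by (intro UnI2 UN_I[of "((i, j), (\<psi> i, \<psi> j))"]) (auto simp: Q_def J_def)
    next
      case False
      have "\<psi> i \<in> U" if "i < R" for i using \<psi> that by (auto simp: T_def)
      then have "\<exists>\<phi>\<in>emb W A U C. \<exists>h\<in>W \<rightarrow>\<^sub>E {..<R}. inj_on h W \<and> (\<forall>x\<in>W. \<psi> (h x) = \<phi> x)"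
        using False \<psi> by (intro copy_in_tuple) (auto simp: T_def Z_def)
      then obtain \<phi> h where "\<phi> \<in> E" "h \<in> H" "\<forall>x\<in>W. \<psi> (h x) = \<phi> x"
        by (auto simp: E_def H_def)
      then show ?thesis using \<psi>
        by (intro UnI1 UN_I[of "(\<phi>, h)"]) (auto simp: P_def H_def)
    qed
  qed
  have "?u ^ R = card T" using U by (simp add: T_def card_funcsetE)
  also have "\<dots> \<le> card ((\<Union>x\<in>E \<times> H. P x) \<union> (\<Union>x\<in>J \<times> Z. Q x))"
    using finE finH finZ J finT by (intro card_mono cover) (auto simp: P_def Q_def)
  also have "\<dots> \<le> (\<Sum>x\<in>E \<times> H. card (P x)) + (\<Sum>x\<in>J \<times> Z. card (Q x))"
    using finE finH finZ J by (intro order_trans[OF card_Un_le] add_mono card_UN_le) auto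
  also have "(\<Sum>x\<in>E \<times> H. card (P x)) \<le> (\<Sum>x\<in>E \<times> H. ?u ^ (R - k))"
  proof (rule sum_mono)
    fix x assume "x \<in> E \<times> H"
    then obtain \<phi> h where x: "x = (\<phi>, h)" "h \<in> H" by auto
    then have h: "h ` W \<subseteq> {..<R}" "card (h ` W) = k" by (auto simp: H_def card_image)
    then show "card (P x) \<le> ?u ^ (R - k)"
      using card_PiE_prescribed[of "{..<R}" "h ` W" U "\<lambda>t. \<phi> (inv_into W h t)"] U x
      by (simp add: P_def T_def)
  qed
  also have "(\<Sum>x\<in>J \<times> Z. card (Q x)) \<le> (\<Sum>x\<in>J \<times> Z. ?u ^ (R - 2))"
  proof (rule sum_mono)
    fix x assume "x \<in> J \<times> Z"
    then obtain i j a b where x: "x = ((i, j), (a, b))" "i < j" "j < R" by (auto simp: J_def)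
    then show "card (Q x) \<le> ?u ^ (R - 2)"
      using card_PiE_prescribed[of "{..<R}" "{i, j}" U "\<lambda>t. if t = i then a else b"] U
      by (simp add: Q_def T_def numeral_2_eq_2)
  qed
  finally have "?u ^ R \<le> card E * card H * ?u ^ (R - k) + card J * card Z * ?u ^ (R - 2)"
    by (simp add: card_cartesian_product)
  also have "card H \<le> R ^ k"
  proof -
    have "card H \<le> card (W \<rightarrow>\<^sub>E {..<R})" unfolding H_def using finW by (intro card_mono finite_PiE) auto
    then show ?thesis using finW by (simp add: card_funcsetE)
  qed
  also note J(2)
  finally have "?u ^ R \<le> card E * R ^ k * ?u ^ (R - k) + R\<^sup>2 * card Z * ?u ^ (R - 2)"
    by simp
  then have "real ?u ^ R \<le> real (card E) * real R ^ k * real ?u ^ (R - k) + (real R)\<^sup>2 * card Z * real ?u ^ (R - 2)"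
    unfolding of_nat_power[symmetric] of_nat_mult[symmetric] of_nat_add[symmetric] of_nat_le_iff .
  also have "real (card E) * real R ^ k * real ?u ^ (R - k) \<le> real ?u ^ R / 2"
  proof -
    have "real (card E) * real R ^ k * real ?u ^ (R - k)
        \<le> (1 / (2 * R ^ k) * real ?u ^ k) * real R ^ k * real ?u ^ (R - k)"
      using few by (intro mult_right_mono) (auto simp: E_def)
    also have "\<dots> = (real ?u ^ k * real ?u ^ (R - k)) / 2" using Rp by simp
    also have "real ?u ^ k * real ?u ^ (R - k) = real ?u ^ R"
      using R_bounds by (simp add: power_add[symmetric])
    finally show ?thesis .
  qed
  finally have "real ?u ^ R / 2 \<le> (real R)\<^sup>2 * card Z * real ?u ^ (R - 2)" by simp
  also have "real ?u ^ R = (real ?u)\<^sup>2 * real ?u ^ (R - 2)"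
    unfolding power_add[symmetric] using R_bounds by (intro arg_cong[where f = "\<lambda>i. _ ^ i"]) simp
  finally have Z1: "(real ?u)\<^sup>2 / 2 \<le> (real R)\<^sup>2 * card Z"
    using u by simp
  \<comment> \<open>A crude cover: the square of a missing pair has four elements, two of them
    diagonal. The factor 4 becomes part of the constant 16.\<close>
  have "Z \<subseteq> (\<lambda>x. (x, x)) ` U \<union> (\<Union>e\<in>missing U C. e \<times> e)"
  proof
    fix z assume "z \<in> Z"
    then obtain x y where z: "z = (x, y)" "x \<in> U" "y \<in> U" "x = y \<or> {x, y} \<in> missing U C"
      unfolding Z_def missing_def by blast
    then show "z \<in> (\<lambda>x. (x, x)) ` U \<union> (\<Union>e\<in>missing U C. e \<times> e)"
      by (cases "x = y") auto
  qed
  then have "card Z \<le> card ((\<lambda>x. (x, x)) ` U \<union> (\<Union>e\<in>missing U C. e \<times> e))"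
    using U finite_missing[OF U(1)] by (intro card_mono) (auto simp: missing_def)
  also have "\<dots> \<le> ?u + (\<Sum>e\<in>missing U C. card (e \<times> e))"
    using U finite_missing[OF U(1)]
    by (intro order_trans[OF card_Un_le] add_mono card_UN_le card_image_le) auto
  also have "(\<Sum>e\<in>missing U C. card (e \<times> e)) = (\<Sum>e\<in>missing U C. 4)"
    by (rule sum.cong) (auto simp: missing_def card_cartesian_product)
  finally have "card Z \<le> ?u + 4 * card (missing U C)" by simp
  then have "(real R)\<^sup>2 * card Z \<le> (real R)\<^sup>2 * (real ?u + 4 * card (missing U C))"
    by (intro mult_left_mono) auto
  with Z1 have "(real ?u)\<^sup>2 / 2 \<le> (real R)\<^sup>2 * real ?u + 4 * (real R)\<^sup>2 * card (missing U C)"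
    by (simp add: algebra_simps)
  \<comment> \<open>The size assumption on \<open>U\<close> makes the diagonal part of
    \<open>Z\<close> at most half of the lower bound for |Z|.\<close>
  moreover have "4 * (real R)\<^sup>2 * real ?u \<le> (real ?u)\<^sup>2"
  proof -
    have "4 * (real R)\<^sup>2 \<le> real ?u" using U(2) by (metis of_nat_le_iff of_nat_mult of_nat_numeral of_nat_power)
    then show ?thesis unfolding power2_eq_square[of "real ?u"] by (rule mult_right_mono) simp
  qed
  ultimately have "(real ?u)\<^sup>2 \<le> 16 * (real R)\<^sup>2 * card (missing U C)" by linarith
  then show ?thesis using Rp by (simp add: field_simps)
qed

text \<open>Containers are turned into sets of unordered pairs. Since \<open>missing\<close> is
  antitone, the pairs missed by a container are missed by every digraph inside it, and these sets do
  not depend on the random graph.\<close>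

theorem missing_containers:
  "\<exists>\<gamma>>0::real. \<exists>t u0::nat. \<forall>U :: 'b set. finite U \<longrightarrow> u0 \<le> card U \<longrightarrow>
    (\<exists>\<M>. finite \<M> \<and>
      card \<M> \<le> ((card U)\<^sup>2 + 1) ^ (t * (nat \<lceil>real (card U) powr (2 - 1 / d)\<rceil> + 1)) \<and>
      (\<forall>M\<in>\<M>. M \<subseteq> {e. e \<subseteq> U \<and> card e = 2} \<and> \<gamma> * (real (card U))\<^sup>2 \<le> real (card M)) \<and>
      (\<forall>D\<subseteq>U \<times> U. emb W A U D = {} \<longrightarrow> (\<exists>M\<in>\<M>. M \<subseteq> missing U D)))"
proof -
  define \<delta> :: real where "\<delta> = 1 / (2 * R ^ k)"
  have Rp: "0 < real R" using R_bounds by simp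
  have "0 < \<delta>" using Rp by (simp add: \<delta>_def)
  from emb_containers[OF this, where 'b = 'b] obtain t :: nat where
    t: "\<forall>U :: 'b set. finite U \<longrightarrow> U \<noteq> {} \<longrightarrow>
    (\<exists>\<C>. finite \<C> \<and>
      card \<C> \<le> ((card U)\<^sup>2 + 1) ^ (t * (nat \<lceil>real (card U) powr (2 - 1 / d)\<rceil> + 1)) \<and>
      (\<forall>C\<in>\<C>. C \<subseteq> U \<times> U \<and> card (emb W A U C) < \<delta> * real (card U) ^ k) \<and>
      (\<forall>D\<subseteq>U \<times> U. emb W A U D = {} \<longrightarrow> (\<exists>C\<in>\<C>. D \<subseteq> C)))"
    by (elim exE) (rule that)
  show ?thesis
  proof (rule exI[of _ "1 / (16 * (real R)\<^sup>2)"], rule conjI[rotated], rule exI[of _ t],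
      rule exI[of _ "4 * R\<^sup>2"], intro allI impI)
    show "0 < 1 / (16 * (real R)\<^sup>2)" using Rp by simp
    fix U :: "'b set" assume U: "finite U" "4 * R\<^sup>2 \<le> card U"
    then have "U \<noteq> {}" using R_bounds by auto
    from t[rule_format, OF U(1) this] obtain \<C> where \<C>: "finite \<C>"
      "card \<C> \<le> ((card U)\<^sup>2 + 1) ^ (t * (nat \<lceil>real (card U) powr (2 - 1 / d)\<rceil> + 1))"
      "\<forall>C\<in>\<C>. C \<subseteq> U \<times> U \<and> card (emb W A U C) < \<delta> * real (card U) ^ k"
      "\<forall>D\<subseteq>U \<times> U. emb W A U D = {} \<longrightarrow> (\<exists>C\<in>\<C>. D \<subseteq> C)"
      by (elim exE conjE) (rule that)
    have "card (missing U ` \<C>) \<le> card \<C>" using \<C>(1) by (rule card_image_le)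
    then have "card (missing U ` \<C>) \<le> ((card U)\<^sup>2 + 1) ^ (t * (nat \<lceil>real (card U) powr (2 - 1 / d)\<rceil> + 1))"
      using \<C>(2) by (rule order_trans)
    moreover have "M \<subseteq> {e. e \<subseteq> U \<and> card e = 2}" if "M \<in> missing U ` \<C>" for M
      using that by (auto simp: missing_def)
    moreover have "1 / (16 * (real R)\<^sup>2) * (real (card U))\<^sup>2 \<le> real (card M)" if "M \<in> missing U ` \<C>" for M
      using that \<C>(3) few_copies_imp_missing[OF U] by (auto simp: \<delta>_def)
    moreover have "\<exists>M\<in>missing U ` \<C>. M \<subseteq> missing U D" if D: "D \<subseteq> U \<times> U" "emb W A U D = {}" for D
    proof -
      obtain C where C: "C \<in> \<C>" "D \<subseteq> C" using \<C>(4) D by meson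
      show ?thesis using missing_mono[OF C(2)] by (intro bexI[of _ "missing U C"] imageI C)
    qed
    ultimately show "\<exists>\<M>. finite \<M> \<and>
      card \<M> \<le> ((card U)\<^sup>2 + 1) ^ (t * (nat \<lceil>real (card U) powr (2 - 1 / d)\<rceil> + 1)) \<and>
      (\<forall>M\<in>\<M>. M \<subseteq> {e. e \<subseteq> U \<and> card e = 2} \<and> 1 / (16 * (real R)\<^sup>2) * (real (card U))\<^sup>2 \<le> real (card M)) \<and>
      (\<forall>D\<subseteq>U \<times> U. emb W A U D = {} \<longrightarrow> (\<exists>M\<in>\<M>. M \<subseteq> missing U D))"
      using \<C>(1) by (intro exI[of _ "missing U ` \<C>"] conjI ballI allI impI finite_imageI)
  qed
qed

end

section \<open>The random graph\<close>

lemma finite_complete_edges: "finite (complete_edges n)"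
  by (rule finite_subset[of _ "Pow {..<n}"]) (auto simp: complete_edges_def)

lemma prob_gnp_superset:
  assumes q: "0 \<le> q" "q \<le> 1" and E: "E \<subseteq> complete_edges n"
  shows "measure_pmf.prob (gnp n q) {G. E \<subseteq> uedges G} = q ^ card E"
proof -
  let ?C = "complete_edges n"
  have "measure_pmf.prob (gnp n q) {G. E \<subseteq> uedges G} =
      measure_pmf.prob (Pi_pmf ?C False (\<lambda>_. bernoulli_pmf q)) (Pi ?C (\<lambda>e. if e \<in> E then {True} else UNIV))"
    unfolding gnp_def measure_map_pmf using E by (intro arg_cong2[where f = measure]) (auto simp: Pi_def split: if_splits)
  also have "\<dots> = (\<Prod>e\<in>?C. measure_pmf.prob (bernoulli_pmf q) (if e \<in> E then {True} else UNIV))"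
    by (rule measure_Pi_pmf_Pi[OF finite_complete_edges])
  also have "\<dots> = (\<Prod>e\<in>?C. if e \<in> E then q else 1)"
    using q by (intro prod.cong) (auto simp: measure_pmf_single)
  also have "\<dots> = q ^ card E"
    using E finite_complete_edges by (subst prod.If_cases) (auto simp: Int_absorb1)
  finally show ?thesis .
qed

lemma prob_gnp_disjoint:
  assumes q: "0 \<le> q" "q \<le> 1" and M: "M \<subseteq> complete_edges n"
  shows "measure_pmf.prob (gnp n q) {G. M \<inter> uedges G = {}} = (1 - q) ^ card M"
proof -
  let ?C = "complete_edges n"
  have "measure_pmf.prob (gnp n q) {G. M \<inter> uedges G = {}} =
      measure_pmf.prob (Pi_pmf ?C False (\<lambda>_. bernoulli_pmf q)) (Pi ?C (\<lambda>e. if e \<in> M then {False} else UNIV))"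
    unfolding gnp_def measure_map_pmf using M by (intro arg_cong2[where f = measure]) (auto simp: Pi_def split: if_splits)
  also have "\<dots> = (\<Prod>e\<in>?C. measure_pmf.prob (bernoulli_pmf q) (if e \<in> M then {False} else UNIV))"
    by (rule measure_Pi_pmf_Pi[OF finite_complete_edges])
  also have "\<dots> = (\<Prod>e\<in>?C. if e \<in> M then 1 - q else 1)"
    using q by (intro prod.cong) (auto simp: measure_pmf_single)
  also have "\<dots> = (1 - q) ^ card M"
    using M finite_complete_edges by (subst prod.If_cases) (auto simp: Int_absorb1)
  finally show ?thesis .
qed

lemma set_gnp: "G \<in> set_pmf (gnp n q) \<Longrightarrow> uverts G = {..<n} \<and> uedges G \<subseteq> complete_edges n"
  by (auto simp: gnp_def)

lemma finite_set_gnp: "finite (set_pmf (gnp n q))"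
proof (rule finite_subset)
  show "set_pmf (gnp n q) \<subseteq> (\<lambda>E. \<lparr>uverts = {..<n}, uedges = E\<rparr>) ` Pow (complete_edges n)"
    unfolding gnp_def by auto
qed (simp add: finite_complete_edges)

text \<open>Both \<open>U\<close> and \<open>D\<close> are quantified inside the event, so later
  they may depend on the graph and its orientation; the cliques and the copy of F can then come from
  the same random graph. The bound has one factor for the choice of \<open>U\<close>, one for the
  choice of a container, and one for the absence of all its missing pairs.\<close>

lemma (in acyclic_template) prob_bad_subset:
  "\<exists>\<gamma>>0::real. \<exists>t u0::nat. \<forall>n u q. u0 \<le> u \<longrightarrow> 0 \<le> q \<longrightarrow> q \<le> 1 \<longrightarrow>
    measure_pmf.prob (gnp n q) {G. \<exists>U D. U \<subseteq> {..<n} \<and> card U = u \<and> D \<subseteq> U \<times> U \<and>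
        (\<forall>e\<in>uedges G. e \<subseteq> U \<longrightarrow> (\<exists>x y. e = {x, y} \<and> (x, y) \<in> D)) \<and> emb W A U D = {}}
    \<le> real n ^ u * real (u\<^sup>2 + 1) ^ (t * (nat \<lceil>real u powr (2 - 1 / d)\<rceil> + 1)) * exp (- (q * \<gamma> * (real u)\<^sup>2))"
proof -
  from missing_containers[where 'b = nat] obtain \<gamma> :: real and t u0 :: nat where \<gamma>: "0 < \<gamma>" and
    cont: "\<forall>U :: nat set. finite U \<longrightarrow> u0 \<le> card U \<longrightarrow>
    (\<exists>\<M>. finite \<M> \<and>
      card \<M> \<le> ((card U)\<^sup>2 + 1) ^ (t * (nat \<lceil>real (card U) powr (2 - 1 / d)\<rceil> + 1)) \<and>
      (\<forall>M\<in>\<M>. M \<subseteq> {e. e \<subseteq> U \<and> card e = 2} \<and> \<gamma> * (real (card U))\<^sup>2 \<le> real (card M)) \<and>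
      (\<forall>D\<subseteq>U \<times> U. emb W A U D = {} \<longrightarrow> (\<exists>M\<in>\<M>. M \<subseteq> missing U D)))"
    by (elim exE conjE) (rule that)
  show ?thesis
  proof (rule exI[of _ \<gamma>], rule conjI[OF \<gamma>], rule exI[of _ t], rule exI[of _ u0], intro allI impI)
    fix n u :: nat and q :: real
    assume u: "u0 \<le> u" and q: "0 \<le> q" "q \<le> 1"
    let ?B = "(u\<^sup>2 + 1) ^ (t * (nat \<lceil>real u powr (2 - 1 / d)\<rceil> + 1))"
    let ?P = "measure_pmf.prob (gnp n q)"
    define \<U> where "\<U> = {U. U \<subseteq> {..<n} \<and> card U = u}"
    have fin\<U>: "finite \<U>" unfolding \<U>_def by (rule finite_subset[of _ "Pow {..<n}"]) auto
    have "\<forall>U\<in>\<U>. \<exists>\<M>. finite \<M> \<and> card \<M> \<le> ?B \<and>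
      (\<forall>M\<in>\<M>. M \<subseteq> {e. e \<subseteq> U \<and> card e = 2} \<and> \<gamma> * (real u)\<^sup>2 \<le> real (card M)) \<and>
      (\<forall>D\<subseteq>U \<times> U. emb W A U D = {} \<longrightarrow> (\<exists>M\<in>\<M>. M \<subseteq> missing U D))"
    proof
      fix U assume "U \<in> \<U>"
      then have U: "finite U" "card U = u" by (auto simp: \<U>_def finite_subset)
      show "\<exists>\<M>. finite \<M> \<and> card \<M> \<le> ?B \<and>
        (\<forall>M\<in>\<M>. M \<subseteq> {e. e \<subseteq> U \<and> card e = 2} \<and> \<gamma> * (real u)\<^sup>2 \<le> real (card M)) \<and>
        (\<forall>D\<subseteq>U \<times> U. emb W A U D = {} \<longrightarrow> (\<exists>M\<in>\<M>. M \<subseteq> missing U D))"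
        using cont[rule_format, OF U(1)] u unfolding U(2) .
    qed
    from bchoice[OF this] obtain \<M> where \<M>: "\<forall>U\<in>\<U>. finite (\<M> U) \<and> card (\<M> U) \<le> ?B \<and>
      (\<forall>M\<in>\<M> U. M \<subseteq> {e. e \<subseteq> U \<and> card e = 2} \<and> \<gamma> * (real u)\<^sup>2 \<le> real (card M)) \<and>
      (\<forall>D\<subseteq>U \<times> U. emb W A U D = {} \<longrightarrow> (\<exists>M\<in>\<M> U. M \<subseteq> missing U D))"
      by (elim exE) (rule that)
    let ?A = "\<lambda>M. {G :: nat ugraph. M \<inter> uedges G = {}}"
    let ?bad = "{G :: nat ugraph. \<exists>U D. U \<subseteq> {..<n} \<and> card U = u \<and> D \<subseteq> U \<times> U \<and>
        (\<forall>e\<in>uedges G. e \<subseteq> U \<longrightarrow> (\<exists>x y. e = {x, y} \<and> (x, y) \<in> D)) \<and> emb W A U D = {}}"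
    have "?bad \<subseteq> (\<Union>U\<in>\<U>. \<Union>M\<in>\<M> U. ?A M)"
    proof
      fix G assume "G \<in> ?bad"
      then obtain U D where U: "U \<in> \<U>" and D: "D \<subseteq> U \<times> U" "emb W A U D = {}"
        and or: "\<And>e. e \<in> uedges G \<Longrightarrow> e \<subseteq> U \<Longrightarrow> \<exists>x y. e = {x, y} \<and> (x, y) \<in> D"
        by (auto simp: \<U>_def)
      obtain M where M: "M \<in> \<M> U" "M \<subseteq> missing U D"
        using bspec[OF \<M> U] D by meson
      \<comment> \<open>An edge inside \<open>U\<close> has one of its directions in
        \<open>D\<close>, whereas pairs in \<open>M\<close> have neither.\<close>
      have "M \<inter> uedges G = {}"
      proof (rule ccontr)
        assume "M \<inter> uedges G \<noteq> {}"
        then obtain e where e: "e \<in> M" "e \<in> uedges G" by blast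
        from e(1) M(2) obtain x y where xy: "e = {x, y}" "x \<in> U" "y \<in> U" "(x, y) \<notin> D" "(y, x) \<notin> D"
          by (auto simp: missing_def)
        then show False using or[OF e(2)] by (auto simp: doubleton_eq_iff)
      qed
      then show "G \<in> (\<Union>U\<in>\<U>. \<Union>M\<in>\<M> U. ?A M)" using U M by blast
    qed
    then have "?P ?bad \<le> ?P (\<Union>U\<in>\<U>. \<Union>M\<in>\<M> U. ?A M)"
      by (intro measure_pmf.finite_measure_mono) auto
    also have "\<dots> \<le> (\<Sum>U\<in>\<U>. ?P (\<Union>M\<in>\<M> U. ?A M))"
      using fin\<U> by (intro measure_pmf.finite_measure_subadditive_finite) auto
    also have "\<dots> \<le> (\<Sum>U\<in>\<U>. real ?B * exp (- (q * \<gamma> * (real u)\<^sup>2)))"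
    proof (rule sum_mono)
      fix U assume U: "U \<in> \<U>"
      note MU = bspec[OF \<M> U]
      have "?P (\<Union>M\<in>\<M> U. ?A M) \<le> (\<Sum>M\<in>\<M> U. ?P (?A M))"
        using MU by (intro measure_pmf.finite_measure_subadditive_finite) auto
      also have "\<dots> \<le> (\<Sum>M\<in>\<M> U. exp (- (q * \<gamma> * (real u)\<^sup>2)))"
      proof (rule sum_mono)
        fix M assume "M \<in> \<M> U"
        then have M: "M \<subseteq> {e. e \<subseteq> U \<and> card e = 2}" "\<gamma> * (real u)\<^sup>2 \<le> real (card M)"
          using MU by auto
        then have "M \<subseteq> complete_edges n" using U by (auto simp: \<U>_def complete_edges_def)
        from prob_gnp_disjoint[OF q this] have "?P (?A M) = (1 - q) ^ card M" .
        also have "\<dots> \<le> exp (- q) ^ card M"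
          using q exp_ge_add_one_self[of "- q"] by (intro power_mono) auto
        also have "\<dots> = exp (- (q * card M))" by (simp add: exp_of_nat_mult[symmetric] mult.commute)
        also have "\<dots> \<le> exp (- (q * \<gamma> * (real u)\<^sup>2))"
          using mult_left_mono[OF M(2) q(1)] by (simp add: mult.assoc)
        finally show "?P (?A M) \<le> exp (- (q * \<gamma> * (real u)\<^sup>2))" .
      qed
      also have "\<dots> = real (card (\<M> U)) * exp (- (q * \<gamma> * (real u)\<^sup>2))" by simp
      also have "\<dots> \<le> real ?B * exp (- (q * \<gamma> * (real u)\<^sup>2))"
        using MU by (intro mult_right_mono of_nat_mono) auto
      finally show "?P (\<Union>M\<in>\<M> U. ?A M) \<le> real ?B * exp (- (q * \<gamma> * (real u)\<^sup>2))" .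
    qed
    also have "\<dots> = real (card \<U>) * (real ?B * exp (- (q * \<gamma> * (real u)\<^sup>2)))" by simp
    also have "\<dots> \<le> real n ^ u * (real ?B * exp (- (q * \<gamma> * (real u)\<^sup>2)))"
    proof (rule mult_right_mono)
      have "card \<U> = n choose u" unfolding \<U>_def using n_subsets[of "{..<n}" u] by simp
      also have "\<dots> \<le> n ^ u" by (cases "u \<le> n") (auto simp: binomial_le_pow binomial_eq_0 not_le)
      finally show "real (card \<U>) \<le> real n ^ u" by (metis of_nat_le_iff of_nat_power)
    qed simp
    finally show "?P ?bad \<le> real n ^ u * real (u\<^sup>2 + 1) ^ (t * (nat \<lceil>real u powr (2 - 1 / d)\<rceil> + 1))
        * exp (- (q * \<gamma> * (real u)\<^sup>2))"
      by (simp only: of_nat_power mult.assoc)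
  qed
qed

text \<open>
  Discarding every event that is in conflict with another one costs at most the number of ordered
  conflicting pairs, which is controlled by Markov's inequality; Chebyshev's inequality bounds the
  total number of events from below.
\<close>

lemma prob_many_unconflicted:
  fixes \<Omega> :: "'o pmf" and Ev :: "'q \<Rightarrow> 'o set" and conflict :: "'q \<Rightarrow> 'q \<Rightarrow> bool"
  assumes fin: "finite (set_pmf \<Omega>)" "finite \<K>"
  defines "\<mu> \<equiv> (\<Sum>Q\<in>\<K>. measure_pmf.prob \<Omega> (Ev Q))"
  assumes indep: "\<And>Q Q'. Q \<in> \<K> \<Longrightarrow> Q' \<in> \<K> \<Longrightarrow> Q \<noteq> Q' \<Longrightarrow> \<not> conflict Q Q' \<Longrightarrow>
      measure_pmf.prob \<Omega> (Ev Q \<inter> Ev Q') = measure_pmf.prob \<Omega> (Ev Q) * measure_pmf.prob \<Omega> (Ev Q')"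
    and conf: "(\<Sum>Q\<in>\<K>. \<Sum>Q'\<in>{Q'\<in>\<K>. conflict Q Q'}. measure_pmf.prob \<Omega> (Ev Q \<inter> Ev Q')) \<le> \<eta> * \<mu>"
    and \<mu>: "0 < \<mu>"
  shows "1 - 4 * (1 + \<eta>) / \<mu> - 4 * \<eta> \<le> measure_pmf.prob \<Omega>
    {\<omega>. \<mu> / 4 \<le> card {Q \<in> \<K>. \<omega> \<in> Ev Q \<and> (\<forall>Q'\<in>\<K>. \<omega> \<in> Ev Q' \<longrightarrow> \<not> conflict Q Q')}}"
proof -
  let ?P = "measure_pmf.prob \<Omega>"
  let ?E = "measure_pmf.expectation \<Omega>"
  define I where "I Q \<omega> = (indicat_real (Ev Q) \<omega>)" for Q \<omega>
  define X where "X \<omega> = (\<Sum>Q\<in>\<K>. I Q \<omega>)" for \<omega>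
  define Y where "Y \<omega> = (\<Sum>Q\<in>\<K>. \<Sum>Q'\<in>{Q'\<in>\<K>. conflict Q Q'}. I Q \<omega> * I Q' \<omega>)" for \<omega>
  have int: "integrable \<Omega> f" for f :: "'o \<Rightarrow> real"
    using fin(1) by (rule integrable_measure_pmf_finite)
  have II: "I Q \<omega> * I Q' \<omega> = indicat_real (Ev Q \<inter> Ev Q') \<omega>" for Q Q' \<omega>
    by (auto simp: I_def indicator_def)
  have EI: "?E (\<lambda>\<omega>. I Q \<omega> * I Q' \<omega>) = ?P (Ev Q \<inter> Ev Q')" for Q Q'
    unfolding II by simp
  have EI1: "?E (I Q) = ?P (Ev Q)" for Q
  proof -
    have "I Q = indicat_real (Ev Q)" by (auto simp: I_def)
    then show ?thesis by simp
  qed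
  have EX: "?E X = \<mu>"
    unfolding X_def \<mu>_def by (simp add: Bochner_Integration.integral_sum int EI1)
  have EY: "?E Y \<le> \<eta> * \<mu>"
    unfolding Y_def using conf by (simp add: Bochner_Integration.integral_sum int EI)
  have "?E (\<lambda>\<omega>. (X \<omega>)\<^sup>2) = (\<Sum>Q\<in>\<K>. \<Sum>Q'\<in>\<K>. ?P (Ev Q \<inter> Ev Q'))"
    unfolding X_def power2_eq_square sum_product by (simp add: Bochner_Integration.integral_sum int EI)
  \<comment> \<open>Pairs split into diagonal, conflicting and independent ones; the last contribute
    at most the square of the mean and cancel in the variance.\<close>
  also have "\<dots> \<le> (\<Sum>Q\<in>\<K>. \<Sum>Q'\<in>\<K>. (if Q' = Q then ?P (Ev Q) else 0)
      + (if conflict Q Q' then ?P (Ev Q \<inter> Ev Q') else 0) + ?P (Ev Q) * ?P (Ev Q'))"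
    by (intro sum_mono) (use indep in auto)
  also have "\<dots> = \<mu> + (\<Sum>Q\<in>\<K>. \<Sum>Q'\<in>{Q'\<in>\<K>. conflict Q Q'}. ?P (Ev Q \<inter> Ev Q')) + \<mu> * \<mu>"
    unfolding sum.distrib \<mu>_def sum_product
    using fin(2) by (simp add: sum.delta' sum.inter_filter)
  also have "\<dots> \<le> \<mu> + \<eta> * \<mu> + \<mu> * \<mu>" using conf by simp
  finally have var: "measure_pmf.variance \<Omega> X \<le> (1 + \<eta>) * \<mu>"
    using EX by (subst measure_pmf.variance_eq[OF int int]) (simp add: power2_eq_square algebra_simps)
  have "?P {\<omega>. \<mu> / 2 \<le> \<bar>X \<omega> - \<mu>\<bar>} \<le> measure_pmf.variance \<Omega> X / (\<mu> / 2)\<^sup>2"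
    using measure_pmf.Chebyshev_inequality[of X \<Omega> "\<mu> / 2"] int \<mu> by (simp add: EX)
  also have "\<dots> \<le> ((1 + \<eta>) * \<mu>) / (\<mu> / 2)\<^sup>2" using var by (rule divide_right_mono) simp
  also have "\<dots> = 4 * (1 + \<eta>) / \<mu>" using \<mu> by (simp add: power2_eq_square field_simps)
  finally have P1: "?P {\<omega>. \<mu> / 2 \<le> \<bar>X \<omega> - \<mu>\<bar>} \<le> 4 * (1 + \<eta>) / \<mu>" .
  have "0 \<le> Y \<omega>" for \<omega>
    unfolding Y_def by (intro sum_nonneg) (simp add: I_def)
  then have "?P {\<omega>. \<mu> / 4 \<le> Y \<omega>} \<le> ?E Y / (\<mu> / 4)"
    using integral_Markov_inequality_measure[of "measure_pmf \<Omega>" Y UNIV "\<mu> / 4"] \<mu> int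
      by simp
  also have "\<dots> \<le> (\<eta> * \<mu>) / (\<mu> / 4)" using EY \<mu> by (intro divide_right_mono) auto
  also have "\<dots> = 4 * \<eta>" using \<mu> by simp
  finally have P2: "?P {\<omega>. \<mu> / 4 \<le> Y \<omega>} \<le> 4 * \<eta>" .
  let ?good = "{\<omega>. \<mu> / 4 \<le> card {Q \<in> \<K>. \<omega> \<in> Ev Q \<and> (\<forall>Q'\<in>\<K>. \<omega> \<in> Ev Q' \<longrightarrow> \<not> conflict Q Q')}}"
  have XY: "X \<omega> - Y \<omega> \<le> card {Q \<in> \<K>. \<omega> \<in> Ev Q \<and> (\<forall>Q'\<in>\<K>. \<omega> \<in> Ev Q' \<longrightarrow> \<not> conflict Q Q')}" for \<omega>
  proof -
    let ?S = "{Q \<in> \<K>. \<omega> \<in> Ev Q \<and> (\<forall>Q'\<in>\<K>. \<omega> \<in> Ev Q' \<longrightarrow> \<not> conflict Q Q')}"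
    have "X \<omega> - Y \<omega> = (\<Sum>Q\<in>\<K>. I Q \<omega> - (\<Sum>Q'\<in>{Q'\<in>\<K>. conflict Q Q'}. I Q \<omega> * I Q' \<omega>))"
      by (simp add: X_def Y_def sum_subtractf)
    also have "\<dots> \<le> (\<Sum>Q\<in>\<K>. if Q \<in> ?S then 1 else 0)"
    proof (rule sum_mono)
      fix Q assume Q: "Q \<in> \<K>"
      have nn: "0 \<le> (\<Sum>Q'\<in>{Q'\<in>\<K>. conflict Q Q'}. I Q \<omega> * I Q' \<omega>)"
        by (intro sum_nonneg) (simp add: I_def)
      show "I Q \<omega> - (\<Sum>Q'\<in>{Q'\<in>\<K>. conflict Q Q'}. I Q \<omega> * I Q' \<omega>) \<le> (if Q \<in> ?S then 1 else 0)"
      \<comment> \<open>If \<open>Q\<close> occurs together with some conflicting \<open>Q'\<close>,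
        the subtracted sum is at least 1 and cancels the contribution of \<open>Q\<close>.\<close>
      proof (cases "\<omega> \<in> Ev Q \<and> Q \<notin> ?S")
        case True
        then obtain Q' where Q': "Q' \<in> {Q'\<in>\<K>. conflict Q Q'}" "\<omega> \<in> Ev Q'" using Q by auto
        have "I Q \<omega> * I Q' \<omega> \<le> (\<Sum>Q'\<in>{Q'\<in>\<K>. conflict Q Q'}. I Q \<omega> * I Q' \<omega>)"
          using Q'(1) fin(2) by (intro member_le_sum) (auto simp: I_def)
        then show ?thesis using True Q' by (simp add: I_def)
      next
        case False
        then show ?thesis using nn by (auto simp: I_def indicator_def)
      qed
    qed
    also have "\<dots> = card ?S"
      using fin(2) by (subst sum.inter_filter[symmetric]) (auto intro!: arg_cong[where f = card])
    finally show ?thesis .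
  qed
  \<comment> \<open>Outside the two exceptional events X > \<open>\<mu>\<close> / 2 and Y <
    \<open>\<mu>\<close> / 4, so X - Y exceeds \<open>\<mu>\<close> / 4.\<close>
  have "UNIV \<subseteq> ?good \<union> ({\<omega>. \<mu> / 2 \<le> \<bar>X \<omega> - \<mu>\<bar>} \<union> {\<omega>. \<mu> / 4 \<le> Y \<omega>})"
  proof
    fix \<omega> :: 'o
    show "\<omega> \<in> ?good \<union> ({\<omega>. \<mu> / 2 \<le> \<bar>X \<omega> - \<mu>\<bar>} \<union> {\<omega>. \<mu> / 4 \<le> Y \<omega>})"
    proof (rule ccontr)
      assume "\<omega> \<notin> ?good \<union> ({\<omega>. \<mu> / 2 \<le> \<bar>X \<omega> - \<mu>\<bar>} \<union> {\<omega>. \<mu> / 4 \<le> Y \<omega>})"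
      then have "\<bar>X \<omega> - \<mu>\<bar> < \<mu> / 2" "Y \<omega> < \<mu> / 4" "\<not> \<mu> / 4 \<le> real (card {Q \<in> \<K>. \<omega> \<in> Ev Q \<and> (\<forall>Q'\<in>\<K>. \<omega> \<in> Ev Q' \<longrightarrow> \<not> conflict Q Q')})"
        by simp_all
      then show False using XY[of \<omega>] by linarith
    qed
  qed
  then have "?P UNIV \<le> ?P (?good \<union> ({\<omega>. \<mu> / 2 \<le> \<bar>X \<omega> - \<mu>\<bar>} \<union> {\<omega>. \<mu> / 4 \<le> Y \<omega>}))"
    by (intro measure_pmf.finite_measure_mono) auto
  also have "\<dots> \<le> ?P ?good + (?P {\<omega>. \<mu> / 2 \<le> \<bar>X \<omega> - \<mu>\<bar>} + ?P {\<omega>. \<mu> / 4 \<le> Y \<omega>})"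
    by (intro order_trans[OF measure_Un_le] add_mono measure_Un_le) auto
  finally show ?thesis using P1 P2 by simp
qed

section \<open>Disjoint copies of K_4 by the second moment method\<close>

definition pairs :: "'b set \<Rightarrow> 'b set set" where
  "pairs Q = {e. e \<subseteq> Q \<and> card e = 2}"

lemma card_pairs: "finite Q \<Longrightarrow> card (pairs Q) = card Q choose 2"
  unfolding pairs_def by (rule n_subsets)

lemma finite_pairs: "finite Q \<Longrightarrow> finite (pairs Q)"
  unfolding pairs_def by (rule finite_subset[of _ "Pow Q"]) auto

lemma card_pairs_Un:
  assumes "finite Q" "finite Q'" "card Q = 4" "card Q' = 4"
  shows "card (pairs Q \<union> pairs Q') = 12 - (card (Q \<inter> Q') choose 2)"
proof -
  have "pairs Q \<inter> pairs Q' = pairs (Q \<inter> Q')" by (auto simp: pairs_def)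
  then have "card (pairs (Q \<inter> Q')) + card (pairs Q \<union> pairs Q') = card (pairs Q) + card (pairs Q')"
    using card_Un_Int[OF finite_pairs finite_pairs, OF assms(1,2)] by simp
  then show ?thesis using assms by (simp add: card_pairs choose_two)
qed

text \<open>Given one K_4, the three terms of \<open>\<eta>\<close> bound the expected number of
  others meeting it in 1, 2 or 3 vertices: these need 3, 2, 1 new vertices and 6, 5, 3 new edges.
  The factor 16 counts the subsets of a 4-set that may serve as the intersection.\<close>

lemma prob_disjoint_cliques:
  fixes q :: real
  assumes q: "0 < q" "q \<le> 1" and n: "4 \<le> n"
  defines "\<mu> \<equiv> real (n choose 4) * q ^ 6"
    and "\<eta> \<equiv> 16 * (real n ^ 3 * q ^ 6 + real n ^ 2 * q ^ 5 + real n * q ^ 3)"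
  shows "1 - 4 * (1 + \<eta>) / \<mu> - 4 * \<eta> \<le> measure_pmf.prob (gnp n q)
    {G. \<exists>\<S>. \<mu> / 4 \<le> card \<S> \<and> disjoint \<S> \<and> (\<forall>Q\<in>\<S>. Q \<subseteq> {..<n} \<and> card Q = 4 \<and> pairs Q \<subseteq> uedges G)}"
proof -
  define \<K> where "\<K> = {Q. Q \<subseteq> {..<n} \<and> card Q = 4}"
  define Ev where "Ev Q = {G :: nat ugraph. pairs Q \<subseteq> uedges G}" for Q
  define conflict where "conflict Q Q' \<longleftrightarrow> Q \<noteq> Q' \<and> Q \<inter> Q' \<noteq> {}" for Q Q' :: "nat set"
  let ?P = "measure_pmf.prob (gnp n q)"
  have fin\<K>: "finite \<K>" unfolding \<K>_def by (rule finite_subset[of _ "Pow {..<n}"]) auto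
  have \<K>: "finite Q" "card Q = 4" "pairs Q \<subseteq> complete_edges n" if "Q \<in> \<K>" for Q
    using that by (auto simp: \<K>_def pairs_def complete_edges_def finite_subset)
  have PEv: "?P (Ev Q) = q ^ 6" if "Q \<in> \<K>" for Q
    using prob_gnp_superset[of q "pairs Q" n] q \<K>[OF that] by (simp add: Ev_def card_pairs choose_two)
  have PEv2: "?P (Ev Q \<inter> Ev Q') = q ^ (12 - (card (Q \<inter> Q') choose 2))" if "Q \<in> \<K>" "Q' \<in> \<K>" for Q Q'
  proof -
    have "Ev Q \<inter> Ev Q' = {G. pairs Q \<union> pairs Q' \<subseteq> uedges G}" by (auto simp: Ev_def)
    then show ?thesis
      using prob_gnp_superset[of q "pairs Q \<union> pairs Q'" n] q \<K>[OF that(1)] \<K>[OF that(2)]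
        card_pairs_Un[of Q Q'] by simp
  qed
  have \<mu>_eq: "(\<Sum>Q\<in>\<K>. ?P (Ev Q)) = \<mu>"
    using PEv n_subsets[of "{..<n}" 4] by (simp add: \<mu>_def \<K>_def)
  have conf: "(\<Sum>Q'\<in>{Q'\<in>\<K>. conflict Q Q'}. ?P (Ev Q \<inter> Ev Q')) \<le> \<eta> * q ^ 6" if Q: "Q \<in> \<K>" for Q
  proof -
    let ?I = "{I. I \<subseteq> Q \<and> I \<noteq> {} \<and> I \<noteq> Q}"
    let ?K = "\<lambda>I. {Q'\<in>\<K>. Q \<inter> Q' = I}"
    have finI: "finite ?I" by (rule finite_subset[of _ "Pow Q"]) (use \<K>[OF Q] in auto)
    have cardK: "card (?K I) \<le> n ^ (4 - card I)" if I: "I \<in> ?I" for I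
    proof -
      have finI: "finite I" using I \<K>(1)[OF Q] finite_subset by auto
      \<comment> \<open>With the intersection fixed, \<open>Q'\<close> is determined by its 4 - |I|
        vertices outside \<open>Q\<close>.\<close>
      have "inj_on (\<lambda>Q'. Q' - I) (?K I)" by (rule inj_onI) blast
      then have "card (?K I) = card ((\<lambda>Q'. Q' - I) ` ?K I)" by (simp add: card_image)
      also have "\<dots> \<le> card {R. R \<subseteq> {..<n} \<and> card R = 4 - card I}"
      proof (rule card_mono)
        show "finite {R. R \<subseteq> {..<n} \<and> card R = 4 - card I}"
          by (rule finite_subset[of _ "Pow {..<n}"]) auto
        show "(\<lambda>Q'. Q' - I) ` ?K I \<subseteq> {R. R \<subseteq> {..<n} \<and> card R = 4 - card I}"
          using finI by (auto simp: \<K>_def card_Diff_subset)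
      qed
      also have "\<dots> = n choose (4 - card I)" using n_subsets[of "{..<n}"] by simp
      also have "\<dots> \<le> n ^ (4 - card I)" using n by (intro binomial_le_pow) simp
      finally show ?thesis .
    qed
    have "(\<Sum>Q'\<in>{Q'\<in>\<K>. conflict Q Q'}. ?P (Ev Q \<inter> Ev Q')) \<le> (\<Sum>Q'\<in>(\<Union>I\<in>?I. ?K I). ?P (Ev Q \<inter> Ev Q'))"
    proof (rule sum_mono2)
      show "finite (\<Union>I\<in>?I. ?K I)" using finI fin\<K> by simp
      show "{Q'\<in>\<K>. conflict Q Q'} \<subseteq> (\<Union>I\<in>?I. ?K I)"
      proof
        fix Q' assume "Q' \<in> {Q'\<in>\<K>. conflict Q Q'}"
        then have Q': "Q' \<in> \<K>" "Q \<noteq> Q'" "Q \<inter> Q' \<noteq> {}" by (auto simp: conflict_def)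
        have "Q \<inter> Q' \<noteq> Q"
        proof
          assume "Q \<inter> Q' = Q"
          then have "Q \<subseteq> Q'" by blast
          then show False using card_subset_eq[of Q' Q] \<K>[OF Q] \<K>[OF Q'(1)] Q'(2) by simp
        qed
        then show "Q' \<in> (\<Union>I\<in>?I. ?K I)" using Q' by (intro UN_I[of "Q \<inter> Q'"]) auto
      qed
    qed simp
    also have "\<dots> \<le> (\<Sum>I\<in>?I. \<Sum>Q'\<in>?K I. ?P (Ev Q \<inter> Ev Q'))"
      using finI fin\<K> by (intro sum_UN_le) auto
    also have "\<dots> \<le> (\<Sum>I\<in>?I. (real n ^ 3 * q ^ 6 + real n ^ 2 * q ^ 5 + real n * q ^ 3) * q ^ 6)"
    proof (rule sum_mono)
      fix I assume I: "I \<in> ?I"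
      have "card I < 4" using I \<K>[OF Q] psubset_card_mono[of Q I] by auto
      moreover have "card I \<noteq> 0" using I \<K>[OF Q] by (auto dest: finite_subset)
      ultimately have cI: "card I = 1 \<or> card I = 2 \<or> card I = 3" by linarith
      have "(\<Sum>Q'\<in>?K I. ?P (Ev Q \<inter> Ev Q')) = (\<Sum>Q'\<in>?K I. q ^ (12 - (card I choose 2)))"
        by (rule sum.cong) (auto simp: PEv2 Q)
      also have "\<dots> = real (card (?K I)) * q ^ (12 - (card I choose 2))" by simp
      also have "\<dots> \<le> real (n ^ (4 - card I)) * q ^ (12 - (card I choose 2))"
        using cardK[OF I] q by (intro mult_right_mono of_nat_mono) auto
      also have "\<dots> \<le> (real n ^ 3 * q ^ 6 + real n ^ 2 * q ^ 5 + real n * q ^ 3) * q ^ 6"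
      proof -
        have "real (n ^ (4 - card I)) * q ^ (12 - (card I choose 2)) =
          (if card I = 1 then real n ^ 3 * q ^ 6 else if card I = 2 then real n ^ 2 * q ^ 5 else real n * q ^ 3) * q ^ 6"
          using cI by (auto simp: choose_two power_add[symmetric])
        also have "\<dots> \<le> (real n ^ 3 * q ^ 6 + real n ^ 2 * q ^ 5 + real n * q ^ 3) * q ^ 6"
          using q by (intro mult_right_mono) auto
        finally show ?thesis .
      qed
      finally show "(\<Sum>Q'\<in>?K I. ?P (Ev Q \<inter> Ev Q')) \<le> (real n ^ 3 * q ^ 6 + real n ^ 2 * q ^ 5 + real n * q ^ 3) * q ^ 6" .
    qed
    also have "\<dots> = real (card ?I) * ((real n ^ 3 * q ^ 6 + real n ^ 2 * q ^ 5 + real n * q ^ 3) * q ^ 6)" by simp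
    also have "\<dots> \<le> 16 * ((real n ^ 3 * q ^ 6 + real n ^ 2 * q ^ 5 + real n * q ^ 3) * q ^ 6)"
    proof (rule mult_right_mono)
      have "card ?I \<le> card (Pow Q)" using \<K>[OF Q] by (intro card_mono) auto
      then show "real (card ?I) \<le> 16" using \<K>[OF Q] by (simp add: card_Pow)
    qed (use q in simp)
    finally show ?thesis by (simp only: \<eta>_def mult.assoc)
  qed
  have main: "1 - 4 * (1 + \<eta>) / \<mu> - 4 * \<eta> \<le> ?P
    {G. \<mu> / 4 \<le> card {Q \<in> \<K>. G \<in> Ev Q \<and> (\<forall>Q'\<in>\<K>. G \<in> Ev Q' \<longrightarrow> \<not> conflict Q Q')}}"
    unfolding \<mu>_eq[symmetric]
  proof (rule prob_many_unconflicted[OF finite_set_gnp fin\<K>])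
    fix Q Q' assume Q: "Q \<in> \<K>" "Q' \<in> \<K>" "Q \<noteq> Q'" "\<not> conflict Q Q'"
    then have "Q \<inter> Q' = {}" by (auto simp: conflict_def)
    then show "?P (Ev Q \<inter> Ev Q') = ?P (Ev Q) * ?P (Ev Q')"
      using Q by (simp add: PEv PEv2 binomial_eq_0 power_add[symmetric])
  next
    have "(\<Sum>Q\<in>\<K>. \<Sum>Q'\<in>{Q'\<in>\<K>. conflict Q Q'}. ?P (Ev Q \<inter> Ev Q')) \<le> (\<Sum>Q\<in>\<K>. \<eta> * q ^ 6)"
      using conf by (rule sum_mono)
    also have "\<dots> = \<eta> * (\<Sum>Q\<in>\<K>. ?P (Ev Q))" by (simp add: PEv)
    finally show "(\<Sum>Q\<in>\<K>. \<Sum>Q'\<in>{Q'\<in>\<K>. conflict Q Q'}. ?P (Ev Q \<inter> Ev Q')) \<le> \<eta> * (\<Sum>Q\<in>\<K>. ?P (Ev Q))" .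
  next
    show "0 < (\<Sum>Q\<in>\<K>. ?P (Ev Q))" unfolding \<mu>_eq \<mu>_def using q n by simp
  qed
  also have "\<dots> \<le> ?P {G. \<exists>\<S>. \<mu> / 4 \<le> card \<S> \<and> disjoint \<S> \<and> (\<forall>Q\<in>\<S>. Q \<subseteq> {..<n} \<and> card Q = 4 \<and> pairs Q \<subseteq> uedges G)}"
  proof (rule measure_pmf.finite_measure_mono, safe)
    fix G assume "\<mu> / 4 \<le> card {Q \<in> \<K>. G \<in> Ev Q \<and> (\<forall>Q'\<in>\<K>. G \<in> Ev Q' \<longrightarrow> \<not> conflict Q Q')}"
    moreover have "disjoint {Q \<in> \<K>. G \<in> Ev Q \<and> (\<forall>Q'\<in>\<K>. G \<in> Ev Q' \<longrightarrow> \<not> conflict Q Q')}"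
      by (rule pairwiseI) (auto simp: conflict_def disjnt_def)
    ultimately show "\<exists>\<S>. \<mu> / 4 \<le> card \<S> \<and> disjoint \<S> \<and> (\<forall>Q\<in>\<S>. Q \<subseteq> {..<n} \<and> card Q = 4 \<and> pairs Q \<subseteq> uedges G)"
      by (intro exI[of _ "{Q \<in> \<K>. G \<in> Ev Q \<and> (\<forall>Q'\<in>\<K>. G \<in> Ev Q' \<longrightarrow> \<not> conflict Q Q')}"] conjI)
        (auto simp: \<K>_def Ev_def)
  qed simp
  finally show ?thesis .
qed

section \<open>Copies of rooted products\<close>

text \<open>The image of \<open>H\<close> under \<open>g\<close> serves as the copy. It takes only
  the images of arcs of \<open>H\<close>, so it need not be induced.\<close>

lemma contains_copyI:
  fixes D :: "'b pair_pre_digraph" and H :: "'c pair_pre_digraph"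
  assumes D: "pair_wf_digraph D" and H: "pair_wf_digraph H"
    and g: "inj_on g (pverts H)" "g ` pverts H \<subseteq> pverts D"
    and arcs: "\<And>x y. (x, y) \<in> parcs H \<Longrightarrow> (g x, g y) \<in> parcs D"
  shows "contains_copy D H"
proof -
  define K where "K = \<lparr>pverts = g ` pverts H, parcs = map_prod g g ` parcs H\<rparr>"
  interpret D: pair_wf_digraph D by fact
  interpret H: pair_wf_digraph H by fact
  have wfK: "wf_digraph (with_proj K)"
    using H.in_arcsD1 H.in_arcsD2 by unfold_locales (auto simp: K_def)
  have "subgraph (with_proj K) (with_proj D)"
    unfolding subgraph_def compatible_def
    using wfK D.wf_digraph_axioms g(2) arcs by (auto simp: K_def)
  moreover have "digraph_iso (with_proj H) (with_proj K)"
  proof -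
    define f :: "('c, 'c \<times> 'c, 'b, 'b \<times> 'b) digraph_isomorphism"
      where "f = \<lparr>iso_verts = g, iso_arcs = map_prod g g, iso_head = snd, iso_tail = fst\<rparr>"
    have "inj_on (map_prod g g) (parcs H)"
      using H.in_arcsD1 H.in_arcsD2 by (intro inj_on_subset[OF map_prod_inj_on[OF g(1) g(1)]]) auto
    then have "pre_digraph.digraph_isomorphism (with_proj H) f"
      unfolding pre_digraph.digraph_isomorphism_def using g(1) H.wf_digraph_axioms by (simp add: f_def)
    moreover have "with_proj K = app_iso f (with_proj H)"
      by (simp add: app_iso_def f_def K_def with_proj_def)
    ultimately show ?thesis unfolding digraph_iso_def by blast
  qed
  ultimately show ?thesis unfolding contains_copy_def by blast
qed

text \<open>Connects the cycles of the digraph library with acyclicity of relations: a loop in the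
  transitive closure is a nonempty closed walk, and such a walk contains a cycle.\<close>

lemma acyclic_parcs:
  assumes "acyclically_oriented F"
  shows "acyclic (parcs F)"
proof -
  have F: "pair_digraph F" "\<nexists>c. pre_digraph.cycle (with_proj F) c"
    using assms by (auto simp: acyclically_oriented_def oriented_graph_def)
  interpret pair_digraph F by fact
  show ?thesis
  proof (rule acyclicI, intro allI notI)
    fix x assume "(x, x) \<in> (parcs F)\<^sup>+"
    then obtain c where "awalk x c x" "c \<noteq> []"
      using reachable1_awalk[of x x] by auto
    then have "closed_w c" unfolding closed_w_def by auto
    then show False using closed_w_imp_cycle F(2) by blast
  qed
qed

text \<open>\<open>Max\<close> gives an upper bound only on a finite set. Finiteness holds because a
  subgraph is determined by its vertex set and its edge set.\<close>

lemma rho2_le_m2: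
  assumes "finite (uverts H)" "finite (uedges H)" "usubgraph J H" "uverts J \<noteq> {}"
  shows "rho2 J \<le> m2 H"
proof -
  have "{rho2 J | J. usubgraph J H \<and> uverts J \<noteq> {}}
      \<subseteq> (\<lambda>(V, E). rho2 \<lparr>uverts = V, uedges = E\<rparr>) ` (Pow (uverts H) \<times> Pow (uedges H))"
  proof
    fix x assume "x \<in> {rho2 J | J. usubgraph J H \<and> uverts J \<noteq> {}}"
    then obtain J :: "'a ugraph" where J: "x = rho2 J" "usubgraph J H" by blast
    have "J = \<lparr>uverts = uverts J, uedges = uedges J\<rparr>" by simp
    then show "x \<in> (\<lambda>(V, E). rho2 \<lparr>uverts = V, uedges = E\<rparr>) ` (Pow (uverts H) \<times> Pow (uedges H))"
      using J by (intro image_eqI[of _ _ "(uverts J, uedges J)"]) (auto simp: usubgraph_def rho2_def)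
  qed
  then have "finite {rho2 J | J. usubgraph J H \<and> uverts J \<noteq> {}}"
    by (rule finite_subset) (simp add: assms)
  then show ?thesis unfolding m2_def using assms(3,4) by (intro Max_ge) auto
qed

lemma finite_underlying:
  assumes "pair_digraph F"
  shows "finite (uverts (underlying F))" "finite (uedges (underlying F))"
proof -
  interpret pair_digraph F by fact
  have "uedges (underlying F) = (\<lambda>(u, v). {u, v}) ` parcs F" by (auto simp: underlying_def)
  then show "finite (uedges (underlying F))" using pair_finite_arcs by simp
  show "finite (uverts (underlying F))" using pair_finite_verts by (simp add: underlying_def)
qed

text \<open>An arc set \<open>B\<close> is measured by the subgraph with vertex set
  \<open>Field B\<close> and the undirected edges of \<open>B\<close>, which is one of the subgraphs
  in the maximum defining \<open>m2\<close>.\<close>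

lemma acyclic_template_of_digraph:
  assumes F: "acyclically_oriented F" and ne: "pverts F \<noteq> {}" and m2: "1 < m2 (underlying F)"
  shows "acyclic_template (pverts F) (parcs F) (m2 (underlying F))"
proof -
  have or: "oriented_graph F" and pd: "pair_digraph F"
    using F by (auto simp: acyclically_oriented_def oriented_graph_def)
  interpret pair_digraph F by fact
  let ?H = "underlying F"
  have anti: "(v, u) \<notin> parcs F" if "(u, v) \<in> parcs F" for u v
    using or that by (auto simp: oriented_graph_def)
  have noloop: "u \<noteq> v" if "(u, v) \<in> parcs F" for u v
    using pair_no_loops[OF that] by simp
  have fin: "finite (pverts F)" "finite (parcs F)" by (fact pair_finite_verts pair_finite_arcs)+
  show ?thesis
  proof
    show "finite (pverts F)" by (rule fin)
    show "parcs F \<subseteq> pverts F \<times> pverts F" using in_arcsD1 in_arcsD2 by auto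
    show "1 / 2 \<le> m2 ?H" using m2 by simp
    show "acyclic (parcs F)" using F by (rule acyclic_parcs)
    show "parcs F \<noteq> {}"
    proof
      \<comment> \<open>Without edges every 2-density is at most 0, against m2 > 1.\<close>
      assume "parcs F = {}"
      then have noedge: "uedges ?H = {}" by (simp add: underlying_def)
      have le0: "x \<le> 0" if "x \<in> {rho2 J | J. usubgraph J ?H \<and> uverts J \<noteq> {}}" for x
      proof -
        obtain J :: "'a ugraph" where J: "x = rho2 J" "uedges J = {}"
          using \<open>x \<in> _\<close> noedge unfolding usubgraph_def by blast
        then show ?thesis by (simp add: rho2_def divide_nonpos_nonneg)
      qed
      let ?S = "{rho2 J | J. usubgraph J ?H \<and> uverts J \<noteq> {}}"
      have "usubgraph ?H ?H \<and> uverts ?H \<noteq> {}"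
        using fin ne noedge by (auto simp: usubgraph_def simple_graph_def underlying_def)
      then have "?S \<noteq> {}" by blast
      moreover have "finite ?S"
        using noedge finite_underlying[OF pd]
        by (rule_tac finite_subset[of _ "(\<lambda>V. rho2 \<lparr>uverts = V, uedges = {}\<rparr>) ` Pow (uverts ?H)"])
          (auto simp: usubgraph_def rho2_def image_iff)
      ultimately have "m2 ?H \<le> 0" unfolding m2_def using le0 by (subst Max_le_iff) auto
      then show False using m2 by simp
    qed
  next
    fix B assume B: "B \<subseteq> parcs F" "B \<noteq> {}"
    define E where "E = (\<lambda>(u, v). {u, v}) ` B"
    have finB: "finite B" using B fin finite_subset by blast
    \<comment> \<open>No arcs are lost on forgetting directions, since an oriented graph has no
      antiparallel pair.\<close>
    have "inj_on (\<lambda>(u, v). {u, v}) B"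
      by (rule inj_onI) (auto simp: doubleton_eq_iff dest!: subsetD[OF B(1)] dest: anti)
    then have cE: "card E = card B" by (simp add: E_def card_image)
    obtain u v where uv: "(u, v) \<in> B" using B(2) by auto
    have finF: "finite (Field B)" using finB by (rule finite_Field)
    have "{u, v} \<subseteq> Field B" using uv by (auto simp: Field_def)
    from card_mono[OF finF this] have v2: "2 \<le> card (Field B)" using noloop[of u v] uv B by auto
    let ?J = "\<lparr>uverts = Field B, uedges = E\<rparr>"
    have E: "E \<subseteq> {e. e \<subseteq> Field B \<and> card e = 2}"
      using B(1) noloop by (auto simp: E_def Field_def)
    have "Field B \<subseteq> pverts F" using B(1) in_arcsD1 in_arcsD2 by (auto simp: Field_def)
    moreover have "E \<subseteq> uedges ?H"
      using B(1) unfolding E_def underlying_def by clarsimp blast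
    ultimately have "usubgraph ?J ?H"
      using finF E by (auto simp: usubgraph_def simple_graph_def underlying_def)
    moreover have "uverts ?J \<noteq> {}" using v2 by auto
    ultimately have r: "rho2 ?J \<le> m2 ?H"
      using rho2_le_m2[OF finite_underlying[OF pd]] by blast
    have "real (card B) - 1 \<le> m2 ?H * (real (card (Field B)) - 2)"
    \<comment> \<open>On two vertices \<open>rho2\<close> has the special value 1/2, which gives no
      bound on the number of arcs, so they are counted directly.\<close>
    proof (cases "card (Field B) = 2")
      case True
      have "finite {e. e \<subseteq> Field B \<and> card e = 2}"
        by (rule finite_subset[of _ "Pow (Field B)"]) (use finF in auto)
      then have "card E \<le> card {e. e \<subseteq> Field B \<and> card e = 2}" using E by (rule card_mono)
      also have "\<dots> = 1" using n_subsets[OF finF, of 2] True by simp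
      finally show ?thesis using True cE by simp
    next
      case False
      then have "3 \<le> card (Field B)" using v2 by simp
      then show ?thesis using r by (simp add: rho2_def cE field_simps)
    qed
    then show "2 \<le> card (Field B) \<and> real (card B) - 1 \<le> m2 ?H * (real (card (Field B)) - 2)"
      using v2 by simp
  qed
qed

section \<open>Rooted products with the transitive triangle\<close>

lemma pair_digraph_rooted_product:
  assumes "pair_digraph F" "pair_digraph H" "r \<in> pverts H"
  shows "pair_digraph (rooted_product F H r)"
proof -
  interpret F: pair_digraph F by fact
  interpret H: pair_digraph H by fact
  have fin: "finite (pverts (rooted_product F H r))"
    using F.pair_finite_verts H.pair_finite_verts by (simp add: rooted_product_def)
  have sub: "parcs (rooted_product F H r) \<subseteq> pverts (rooted_product F H r) \<times> pverts (rooted_product F H r)"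
    using F.in_arcsD1 F.in_arcsD2 H.in_arcsD1 H.in_arcsD2 assms(3) by (auto simp: rooted_product_def)
  show ?thesis
  proof
    show "finite (parcs (rooted_product F H r))" using finite_subset[OF sub] fin by blast
    show "fst e \<noteq> snd e" if "e \<in> parcs (rooted_product F H r)" for e
      using that F.pair_no_loops H.pair_no_loops by (auto simp: rooted_product_def)
  qed (use fin sub in auto)
qed

lemma pair_digraph_transitive_tournament: "pair_digraph (transitive_tournament k)"
proof
  show "finite (parcs (transitive_tournament k))"
    by (rule finite_subset[of _ "{..<k} \<times> {..<k}"]) (auto simp: transitive_tournament_def)
qed (auto simp: transitive_tournament_def)

lemma two_le_m2_rooted_product_TT3:
  assumes F: "pair_digraph F" and ne: "pverts F \<noteq> {}" and r: "r \<in> pverts (transitive_tournament 3)"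
  shows "2 \<le> m2 (underlying (rooted_product F (transitive_tournament 3) r))"
proof -
  let ?P = "rooted_product F (transitive_tournament 3) r"
  obtain x where x: "x \<in> pverts F" using ne by blast
  let ?J = "\<lparr>uverts = {(x, 0), (x, 1), (x, 2)}, uedges = {{(x, 0), (x, 1)}, {(x, 0), (x, 2)}, {(x, 1), (x, 2)}}\<rparr>
    :: ('a \<times> nat) ugraph"
  have arc: "{(x, i), (x, j)} \<in> uedges (underlying ?P)" if "i < j" "j < 3" for i j
    using x that unfolding underlying_def rooted_product_def transitive_tournament_def by auto
  have "usubgraph ?J (underlying ?P)"
    unfolding usubgraph_def simple_graph_def using x arc[of 0 1] arc[of 0 2] arc[of 1 2]
    by (auto simp: underlying_def rooted_product_def transitive_tournament_def)
  moreover have "uverts ?J \<noteq> {}" by simp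
  moreover have "rho2 ?J = 2"
    by (simp add: rho2_def doubleton_eq_iff)
  ultimately show ?thesis
    using rho2_le_m2[OF finite_underlying[OF pair_digraph_rooted_product[OF F pair_digraph_transitive_tournament r]], of ?J]
    by simp
qed

text \<open>The deterministic core. Each K_4 contains a transitive triangle, listed in order; its
  entry at position \<open>r\<close> is its root, which handles every choice of root alike. F is
  embedded into the set of roots, and disjointness of the cliques keeps the attached triangles
  apart.\<close>

lemma arrows_rooted_product_TT3:
  fixes G :: "nat ugraph"
  assumes F: "pair_digraph F" and r: "r \<in> pverts (transitive_tournament 3)"
    and G: "uverts G = {..<n}"
    and \<S>: "u \<le> card \<S>" "disjoint \<S>" "\<forall>Q\<in>\<S>. Q \<subseteq> {..<n} \<and> card Q = 4 \<and> pairs Q \<subseteq> uedges G"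
    and good: "\<nexists>U D. U \<subseteq> {..<n} \<and> card U = u \<and> D \<subseteq> U \<times> U \<and>
        (\<forall>e\<in>uedges G. e \<subseteq> U \<longrightarrow> (\<exists>x y. e = {x, y} \<and> (x, y) \<in> D)) \<and> emb (pverts F) (parcs F) U D = {}"
  shows "arrows G (rooted_product F (transitive_tournament 3) r)"
  unfolding arrows_def
proof (intro allI impI)
  fix D :: "nat pair_pre_digraph" assume D: "orientation_of D G"
  then have Dpd: "pair_digraph D" and vD: "pverts D = {..<n}"
    and eD: "uedges G = {{x, y} | x y. (x, y) \<in> parcs D}"
    using G by (auto simp: orientation_of_def oriented_graph_def underlying_def)
  interpret D: pair_digraph D by fact
  interpret F: pair_digraph F by fact
  have r3: "r < 3" using r by (simp add: transitive_tournament_def)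
  have adj: "(x, y) \<in> parcs D \<or> (y, x) \<in> parcs D" if "{x, y} \<in> uedges G" for x y
    using that unfolding eD by (auto simp: doubleton_eq_iff)
  have "\<forall>Q\<in>\<S>. \<exists>xs. length xs = 3 \<and> distinct xs \<and> set xs \<subseteq> Q \<and> sorted_wrt (\<lambda>x y. (x, y) \<in> parcs D) xs"
  proof
    fix Q assume Q: "Q \<in> \<S>"
    then have Q': "finite Q" "card Q = 4" "pairs Q \<subseteq> uedges G"
      using \<S>(3) by (auto intro: finite_subset[of _ "{..<n}"])
    have "(x, y) \<in> parcs D \<or> (y, x) \<in> parcs D" if "x \<in> Q" "y \<in> Q" "x \<noteq> y" for x y
      using that Q'(3) by (intro adj) (auto simp: pairs_def)
    from tournament_chain[OF Q'(1) _ this, of 2] Q'(2)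
    show "\<exists>xs. length xs = 3 \<and> distinct xs \<and> set xs \<subseteq> Q \<and> sorted_wrt (\<lambda>x y. (x, y) \<in> parcs D) xs"
      by simp
  qed
  from bchoice[OF this] obtain c where c: "\<And>Q. Q \<in> \<S> \<Longrightarrow> length (c Q) = 3"
      "\<And>Q. Q \<in> \<S> \<Longrightarrow> distinct (c Q)" "\<And>Q. Q \<in> \<S> \<Longrightarrow> set (c Q) \<subseteq> Q"
      "\<And>Q. Q \<in> \<S> \<Longrightarrow> sorted_wrt (\<lambda>x y. (x, y) \<in> parcs D) (c Q)"
    by blast
  \<comment> \<open>Exactly \<open>u\<close> cliques are kept, because the forcing hypothesis
    concerns vertex sets of size exactly \<open>u\<close>.\<close>
  obtain \<S>' where \<S>': "\<S>' \<subseteq> \<S>" "card \<S>' = u" "finite \<S>'"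
    using obtain_subset_with_card_n[OF \<S>(1)] by metis
  define \<rho> where "\<rho> Q = c Q ! r" for Q
  have c_in: "c Q ! i \<in> Q" if "Q \<in> \<S>" "i < 3" for Q i
    using c(1,3)[OF that(1)] that(2) by (metis nth_mem subsetD)
  have c_eq: "Q = Q' \<and> i = j" if "Q \<in> \<S>" "Q' \<in> \<S>" "i < 3" "j < 3" "c Q ! i = c Q' ! j" for Q Q' i j
  proof -
    have "Q = Q'"
    proof (rule ccontr)
      assume "Q \<noteq> Q'"
      then have "Q \<inter> Q' = {}" using \<S>(2) that by (auto simp: pairwise_def disjnt_def)
      then show False using c_in[of Q i] c_in[of Q' j] that by auto
    qed
    then show ?thesis using that c(1,2)[of Q] by (simp add: nth_eq_iff_index_eq)
  qed
  have inj\<rho>: "inj_on \<rho> \<S>'"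
    using c_eq[OF _ _ r3 r3] \<S>'(1) by (auto simp: inj_on_def \<rho>_def)
  define U where "U = \<rho> ` \<S>'"
  have U: "U \<subseteq> {..<n}" "card U = u"
  proof -
    have "\<rho> Q \<in> {..<n}" if "Q \<in> \<S>'" for Q
      using c_in[OF _ r3, of Q] \<S>'(1) \<S>(3) that unfolding \<rho>_def by blast
    then show "U \<subseteq> {..<n}" by (auto simp: U_def)
    show "card U = u" using inj\<rho> \<S>'(2) by (simp add: U_def card_image)
  qed
  have "\<exists>x y. e = {x, y} \<and> (x, y) \<in> parcs D \<inter> U \<times> U" if "e \<in> uedges G" "e \<subseteq> U" for e
    using that unfolding eD by auto
  then have "emb (pverts F) (parcs F) U (parcs D \<inter> U \<times> U) \<noteq> {}"
    using good U by blast
  then obtain \<phi> where "\<phi> \<in> emb (pverts F) (parcs F) U (parcs D \<inter> U \<times> U)" by blast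
  then have \<phi>: "\<phi> \<in> pverts F \<rightarrow>\<^sub>E U" "inj_on \<phi> (pverts F)"
    "\<And>x y. (x, y) \<in> parcs F \<Longrightarrow> (\<phi> x, \<phi> y) \<in> parcs D"
    unfolding emb_def by blast+
  \<comment> \<open>The clique whose triangle is attached at the image of \<open>x\<close>.\<close>
  define K where "K x = inv_into \<S>' \<rho> (\<phi> x)" for x
  have K: "K x \<in> \<S>" "c (K x) ! r = \<phi> x" if "x \<in> pverts F" for x
  proof -
    have "\<phi> x \<in> \<rho> ` \<S>'" using \<phi>(1) that by (auto simp: U_def)
    then show "K x \<in> \<S>" "c (K x) ! r = \<phi> x"
      using \<S>'(1) inv_into_into[of "\<phi> x" \<rho> \<S>'] f_inv_into_f[of "\<phi> x" \<rho> \<S>'] by (auto simp: K_def \<rho>_def)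
  qed
  define g where "g = (\<lambda>(x, i). c (K x) ! i)"
  show "contains_copy D (rooted_product F (transitive_tournament 3) r)"
  proof (rule contains_copyI)
    show "pair_wf_digraph D" by unfold_locales
    have "pair_digraph (rooted_product F (transitive_tournament 3) r)"
      using F r by (intro pair_digraph_rooted_product pair_digraph_transitive_tournament)
    then show "pair_wf_digraph (rooted_product F (transitive_tournament 3) r)"
      by (simp add: pair_digraph_def pair_fin_digraph_def)
    have verts: "pverts (rooted_product F (transitive_tournament 3) r) = pverts F \<times> {..<3}"
      by (simp add: rooted_product_def transitive_tournament_def)
    show "inj_on g (pverts (rooted_product F (transitive_tournament 3) r))"
      unfolding verts
    proof (rule inj_onI)
      fix z z' assume "z \<in> pverts F \<times> {..<3}" "z' \<in> pverts F \<times> {..<3}" "g z = g z'"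
      then obtain x i y j where z: "z = (x, i)" "z' = (y, j)" and a: "x \<in> pverts F" "i \<in> {..<3}" "y \<in> pverts F" "j \<in> {..<3}" "g (x, i) = g (y, j)"
        by blast
      then have eq: "K x = K y \<and> i = j"
        by (intro c_eq) (auto simp: g_def K)
      then have "\<phi> x = \<phi> y" using K(2) a by metis
      then show "z = z'" using \<phi>(2) a eq z by (auto simp: inj_on_def)
    qed
    show "g ` pverts (rooted_product F (transitive_tournament 3) r) \<subseteq> pverts D"
      unfolding verts vD using c_in[OF K(1)] \<S>(3) K(1) by (fastforce simp: g_def)
    fix a b assume ab: "(a, b) \<in> parcs (rooted_product F (transitive_tournament 3) r)"
    then consider x y where "a = (x, r)" "b = (y, r)" "(x, y) \<in> parcs F"
      | x i j where "a = (x, i)" "b = (x, j)" "x \<in> pverts F" "i < j" "j < 3"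
      by (auto simp: rooted_product_def transitive_tournament_def)
    then show "(g a, g b) \<in> parcs D"
    proof cases
      case 1
      then show ?thesis using \<phi>(3) K(2) F.in_arcsD1 F.in_arcsD2 by (simp add: g_def)
    next
      case 2
      then show ?thesis
        using sorted_wrt_nth_less[OF c(4)[OF K(1)]] c(1)[OF K(1)] by (simp add: g_def)
    qed
  qed
qed

section \<open>Asymptotics\<close>

lemma eventually_union_bound_exponent:
  fixes g :: real
  assumes "s < L" "e < L" "0 < s" "0 < e" "0 < g" "0 < t"
  shows "\<forall>\<^sub>F n in sequentially.
    real n powr s * ln (real n) + t * (real n powr e + 2) * (2 * ln (real n) + 1) + ln 4 \<le> g * real n powr L"
proof -
  have "\<forall>\<^sub>F n in sequentially. real n powr s * ln (real n) \<le> g / 3 * real n powr L"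
    using assms by real_asymp
  moreover have "\<forall>\<^sub>F n in sequentially. t * (real n powr e + 2) * (2 * ln (real n) + 1) \<le> g / 3 * real n powr L"
    using assms by real_asymp
  moreover have "\<forall>\<^sub>F n in sequentially. ln 4 \<le> g / 3 * real n powr L"
    using assms by real_asymp
  ultimately show ?thesis by eventually_elim simp
qed

text \<open>Compared on a logarithmic scale: the choice of U costs n^s log n, the containers cost
  n^e log n, and the gain is of order n^L with L = 2 s - a. The assumption a < s gives s < L, and d
  a < s gives e < L.\<close>

lemma eventually_union_bound:
  fixes a s d \<gamma> :: real and t :: nat
  assumes "0 < a" "a < s" "s < 1" "1 / 2 < d" "d * a < s" "0 < \<gamma>"
  defines "u \<equiv> \<lambda>n. nat \<lfloor>real n powr s\<rfloor>"
  shows "\<forall>\<^sub>F n in sequentially. real n ^ u n * real ((u n)\<^sup>2 + 1) ^ (t * (nat \<lceil>real (u n) powr (2 - 1 / d)\<rceil> + 1))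
    * exp (- (real n powr (- a) * \<gamma> * (real (u n))\<^sup>2)) \<le> 1 / 4"
proof -
  define e where "e = s * (2 - 1 / d)"
  define L where "L = 2 * s - a"
  have d: "0 < 2 - 1 / d" using assms by (simp add: field_simps)
  have "a < s / d" using assms by (simp add: field_simps)
  then have eL: "e < L" by (simp add: e_def L_def algebra_simps)
  have e0: "0 < e" using assms d by (simp add: e_def)
  \<comment> \<open>\<open>real t + 1\<close> keeps the coefficient positive even for t = 0. The
    quarter comes from u >= n^s / 2, which loses a factor 4 in u^2.\<close>
  have "\<forall>\<^sub>F n in sequentially. real n powr s * ln (real n)
      + (real t + 1) * (real n powr e + 2) * (2 * ln (real n) + 1) + ln 4 \<le> \<gamma> / 4 * real n powr L"
    using eL e0 assms by (intro eventually_union_bound_exponent) (auto simp: L_def)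
  moreover have "\<forall>\<^sub>F n in sequentially. real n powr s / 2 \<le> real (u n)"
    unfolding u_def using assms by real_asymp
  ultimately show ?thesis using eventually_gt_at_top[of 0]
  proof eventually_elim
    case (elim n)
    let ?u = "real (u n)"
    let ?N = "nat \<lceil>?u powr (2 - 1 / d)\<rceil> + 1"
    have n1: "1 \<le> real n" and ln0: "0 \<le> ln (real n)" using elim by auto
    have us: "?u \<le> real n powr s" by (simp add: u_def)
    also have "\<dots> \<le> real n powr 1" using n1 assms by (intro powr_mono) auto
    finally have un: "?u \<le> real n" using n1 by simp
    have N: "real ?N \<le> real n powr e + 2"
    proof -
      have "?u powr (2 - 1 / d) \<le> (real n powr s) powr (2 - 1 / d)"
        using us d by (intro powr_mono2) auto
      also have "\<dots> = real n powr e" by (simp add: powr_powr e_def)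
      finally have "?u powr (2 - 1 / d) \<le> real n powr e" .
      moreover have "real (nat \<lceil>?u powr (2 - 1 / d)\<rceil>) \<le> ?u powr (2 - 1 / d) + 1"
        using powr_ge_zero[of ?u "2 - 1 / d"] by linarith
      ultimately show ?thesis by linarith
    qed
    have u2: "ln (real ((u n)\<^sup>2 + 1)) \<le> 2 * ln (real n) + 1"
    proof -
      have "real ((u n)\<^sup>2 + 1) \<le> (real n)\<^sup>2 + (real n)\<^sup>2"
      proof -
        have "?u\<^sup>2 \<le> (real n)\<^sup>2" using un by (rule power_mono) simp
        moreover have "1 \<le> (real n)\<^sup>2" using n1 by (rule one_le_power)
        ultimately show ?thesis unfolding of_nat_add of_nat_power of_nat_1 by linarith
      qed
      also have "\<dots> \<le> exp 1 * (real n)\<^sup>2"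
      proof -
        have "2 \<le> exp (1 :: real)" using exp_ge_add_one_self[of "1 :: real"] by simp
        from mult_right_mono[OF this, of "(real n)\<^sup>2"] show ?thesis by simp
      qed
      finally have le: "real ((u n)\<^sup>2 + 1) \<le> exp 1 * (real n)\<^sup>2" .
      have pos: "0 < real ((u n)\<^sup>2 + 1)" unfolding of_nat_0_less_iff by simp
      have "ln (real ((u n)\<^sup>2 + 1)) \<le> ln (exp 1 * (real n)\<^sup>2)"
        using le pos ln_le_cancel_iff[OF pos less_le_trans[OF pos le]] by blast
      also have "\<dots> = 2 * ln (real n) + 1" using n1 by (simp add: ln_mult ln_realpow)
      finally show ?thesis .
    qed
    have l0: "0 \<le> ln (real ((u n)\<^sup>2 + 1))" by (intro ln_ge_zero) simp
    have A: "?u * ln (real n) \<le> real n powr s * ln (real n)"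
      using us ln0 by (rule mult_right_mono)
    have B: "real (t * ?N) * ln (real ((u n)\<^sup>2 + 1))
        \<le> (real t + 1) * (real n powr e + 2) * (2 * ln (real n) + 1)"
      unfolding of_nat_mult by (intro mult_mono N u2 l0 of_nat_0_le_iff) auto
    have C: "\<gamma> / 4 * real n powr L \<le> real n powr (- a) * \<gamma> * ?u\<^sup>2"
    proof -
      have "real n powr L = real n powr (- a) * (real n powr s)\<^sup>2"
        using n1 by (simp add: L_def powr_power powr_add[symmetric])
      then have "\<gamma> / 4 * real n powr L = real n powr (- a) * \<gamma> * (real n powr s / 2)\<^sup>2"
        by (simp add: power_divide)
      also have "\<dots> \<le> real n powr (- a) * \<gamma> * ?u\<^sup>2"
        using elim(2) assms by (intro mult_left_mono power_mono) auto
      finally show ?thesis .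
    qed
    have "real n ^ u n * real ((u n)\<^sup>2 + 1) ^ (t * ?N) = exp (?u * ln (real n) + real (t * ?N) * ln (real ((u n)\<^sup>2 + 1)))"
    proof -
      have "x ^ k = exp (real k * ln x)" if "0 < x" for x :: real and k
        using that by (simp add: exp_of_nat_mult)
      note pow_eq = this
      have "0 < real n" "0 < real ((u n)\<^sup>2 + 1)" using n1 unfolding of_nat_0_less_iff by simp_all
      from pow_eq[OF this(1), of "u n"] pow_eq[OF this(2), of "t * ?N"] show ?thesis
        unfolding exp_add by (simp only:)
    qed
    then have "real n ^ u n * real ((u n)\<^sup>2 + 1) ^ (t * ?N) * exp (- (real n powr (- a) * \<gamma> * ?u\<^sup>2))
        = exp (?u * ln (real n) + real (t * ?N) * ln (real ((u n)\<^sup>2 + 1)) - real n powr (- a) * \<gamma> * ?u\<^sup>2)"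
      by (simp only: exp_add[symmetric] diff_conv_add_uminus)
    also have "\<dots> \<le> exp (- ln 4)" using A B C elim(1) by (subst exp_le_cancel_iff) linarith
    also have "\<dots> = 1 / 4" by (simp add: exp_minus)
    finally show ?case .
  qed
qed

text \<open>The expected number of cliques has exponent 4 - 6 a, positive for a < 2/3. The terms of
  \<open>\<eta>\<close> have exponents 3 - 6 a, 2 - 5 a and 1 - 3 a; the first is the critical one
  and is negative precisely for a > 1/2.\<close>

lemma eventually_disjoint_cliques:
  fixes a s :: real
  assumes a: "1 / 2 < a" "a < 2 / 3" and s: "s < 4 - 6 * a"
  shows "\<forall>\<^sub>F n in sequentially. 3 / 4 \<le> measure_pmf.prob (gnp n (real n powr (- a)))
    {G. \<exists>\<S>. nat \<lfloor>real n powr s\<rfloor> \<le> card \<S> \<and> disjoint \<S> \<and> (\<forall>Q\<in>\<S>. Q \<subseteq> {..<n} \<and> card Q = 4 \<and> pairs Q \<subseteq> uedges G)}"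
proof -
  define \<eta> where "\<eta> n = 16 * (real n ^ 3 * (real n powr (- a)) ^ 6 + real n ^ 2 * (real n powr (- a)) ^ 5
      + real n * (real n powr (- a)) ^ 3)" for n :: nat
  have "\<eta> \<longlonglongrightarrow> 0"
    unfolding \<eta>_def using a by real_asymp
  then have "\<forall>\<^sub>F n in sequentially. \<eta> n < 1 / 32" by (rule order_tendstoD) simp
  \<comment> \<open>The factor 256 = 4^4 is lost in n choose 4 >= (n/4)^4. Then 1024 leaves
    \<open>\<mu>\<close> / 4 >= n^s, and the next bound leaves \<open>\<mu>\<close> >= 64, enough
    for probability 3/4.\<close>
  moreover have "\<forall>\<^sub>F n in sequentially. 1024 * real n powr s \<le> real n ^ 4 * (real n powr (- a)) ^ 6"
    using a s by real_asymp
  moreover have "\<forall>\<^sub>F n in sequentially. 256 * 64 \<le> real n ^ 4 * (real n powr (- a)) ^ 6"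
    using a by real_asymp
  ultimately show ?thesis using eventually_ge_at_top[of 4]
  proof eventually_elim
    case (elim n)
    define q where "q = real n powr (- a)"
    define \<mu> where "\<mu> = real (n choose 4) * q ^ 6"
    let ?A = "\<lambda>x. {G. \<exists>\<S>. x \<le> real (card \<S>) \<and> disjoint \<S> \<and> (\<forall>Q\<in>\<S>. Q \<subseteq> {..<n} \<and> card Q = 4 \<and> pairs Q \<subseteq> uedges G)}"
    have q: "0 < q" "q \<le> 1"
      using elim a by (auto simp: q_def powr_minus intro!: inverse_le_1_iff[THEN iffD2] ge_one_powr_ge_zero)
    have "(real n / 4) ^ 4 \<le> real (n choose 4)"
      using binomial_ge_n_over_k_pow_k[of 4 n, where 'a = real] elim by simp
    then have "real n ^ 4 * q ^ 6 / 256 \<le> \<mu>"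
      unfolding \<mu>_def using mult_right_mono[of _ _ "q ^ 6"] q by (fastforce simp: power_divide)
    then have \<mu>: "4 * real n powr s \<le> \<mu>" "64 \<le> \<mu>"
      using elim(2,3) by (simp_all add: q_def)
    have \<eta>0: "0 \<le> \<eta> n" by (simp add: \<eta>_def)
    define x where "x = 4 * (1 + \<eta> n) / \<mu>"
    have "x \<le> 4 * (1 + 1 / 32) / 64"
      unfolding x_def using \<mu> elim(1) \<eta>0 by (intro frac_le) auto
    then have "3 / 4 \<le> 1 - x - 4 * \<eta> n" using elim(1) by simp
    also have "\<dots> \<le> measure_pmf.prob (gnp n q) (?A (\<mu> / 4))"
      using prob_disjoint_cliques[OF q elim(4)] unfolding x_def \<mu>_def \<eta>_def q_def .
    also have "\<dots> \<le> measure_pmf.prob (gnp n q) (?A (real (nat \<lfloor>real n powr s\<rfloor>)))"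
    proof (rule measure_pmf.finite_measure_mono)
      have "real (nat \<lfloor>real n powr s\<rfloor>) \<le> real n powr s" by (rule of_nat_floor) simp
      then have le: "real (nat \<lfloor>real n powr s\<rfloor>) \<le> \<mu> / 4" using \<mu>(1) by linarith
      then show "?A (\<mu> / 4) \<subseteq> ?A (real (nat \<lfloor>real n powr s\<rfloor>))"
        by (intro Collect_mono impI) (elim exE conjE, intro exI conjI order_trans[OF le])
    qed simp
    finally show ?case unfolding q_def of_nat_le_iff .
  qed
qed

text \<open>The lines d a and 4 - 6 a cross at a = 4 / (d + 6), which exceeds 1/2 exactly when d <
  2. The bound a < 2/3 follows from d > 1.\<close>

lemma ex_exponents:
  fixes d :: real
  assumes "1 < d" "d < 2"
  obtains a s where "1 / 2 < a" "a < 2 / 3" "d * a < s" "s < 4 - 6 * a"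
proof -
  have "1 / 2 < 4 / (d + 6)" using assms by (simp add: field_simps)
  then obtain a where a: "1 / 2 < a" "a < 4 / (d + 6)" using dense by blast
  then have "d * a < 4 - 6 * a" using assms by (simp add: field_simps)
  then obtain s where s: "d * a < s" "s < 4 - 6 * a" using dense by blast
  have "a < a * d" using a assms by simp
  moreover have "a * d + a * 6 < 4" using a assms by (simp add: field_simps)
  ultimately have "a < 2 / 3" by linarith
  then show ?thesis using a s that by blast
qed

theorem eventually_arrows_rooted_product_TT3:
  assumes F: "acyclically_oriented F" "pverts F \<noteq> {}" "1 < m2 (underlying F)" "m2 (underlying F) < 2"
    and r: "r \<in> pverts (transitive_tournament 3)"
  shows "\<exists>a>1 / 2. \<forall>\<^sub>F n in sequentially. 1 / 2 \<le> measure_pmf.prob (gnp n (real n powr (- a)))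
    {G. arrows G (rooted_product F (transitive_tournament 3) r)}"
proof -
  let ?d = "m2 (underlying F)"
  interpret acyclic_template "pverts F" "parcs F" ?d
    using acyclic_template_of_digraph[OF F(1-3)] .
  have pd: "pair_digraph F" using F(1) by (simp add: acyclically_oriented_def oriented_graph_def)
  obtain a s where as: "1 / 2 < a" "a < 2 / 3" "?d * a < s" "s < 4 - 6 * a"
    using ex_exponents[OF F(3,4)] .
  have "a < ?d * a" using as(1) F(3) by simp
  then have "a < s" using as(3) by linarith
  define u where "u n = nat \<lfloor>real n powr s\<rfloor>" for n :: nat
  let ?P = "\<lambda>n. measure_pmf.prob (gnp n (real n powr (- a)))"
  define bad where "bad n = {G :: nat ugraph. \<exists>U D. U \<subseteq> {..<n} \<and> card U = u n \<and> D \<subseteq> U \<times> U \<and>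
        (\<forall>e\<in>uedges G. e \<subseteq> U \<longrightarrow> (\<exists>x y. e = {x, y} \<and> (x, y) \<in> D)) \<and> emb (pverts F) (parcs F) U D = {}}" for n :: nat
  define cl where "cl n = {G :: nat ugraph. \<exists>\<S>. u n \<le> card \<S> \<and> disjoint \<S> \<and> (\<forall>Q\<in>\<S>. Q \<subseteq> {..<n} \<and> card Q = 4 \<and> pairs Q \<subseteq> uedges G)}" for n
  let ?good = "{G. arrows G (rooted_product F (transitive_tournament 3) r)}"
  obtain \<gamma> :: real and t u0 :: nat where \<gamma>: "0 < \<gamma>" and
    pb: "\<forall>n u q. u0 \<le> u \<longrightarrow> 0 \<le> q \<longrightarrow> q \<le> 1 \<longrightarrow>
    measure_pmf.prob (gnp n q) {G. \<exists>U D. U \<subseteq> {..<n} \<and> card U = u \<and> D \<subseteq> U \<times> U \<and>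
        (\<forall>e\<in>uedges G. e \<subseteq> U \<longrightarrow> (\<exists>x y. e = {x, y} \<and> (x, y) \<in> D)) \<and> emb (pverts F) (parcs F) U D = {}}
    \<le> real n ^ u * real (u\<^sup>2 + 1) ^ (t * (nat \<lceil>real u powr (2 - 1 / ?d)\<rceil> + 1)) * exp (- (q * \<gamma> * (real u)\<^sup>2))"
    using prob_bad_subset by (elim exE conjE) (rule that)
  have "\<forall>\<^sub>F n in sequentially. real n ^ u n * real ((u n)\<^sup>2 + 1) ^ (t * (nat \<lceil>real (u n) powr (2 - 1 / ?d)\<rceil> + 1))
    * exp (- (real n powr (- a) * \<gamma> * (real (u n))\<^sup>2)) \<le> 1 / 4"
    unfolding u_def using as \<open>a < s\<close> F(3) \<gamma> by (intro eventually_union_bound) auto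
  moreover have "\<forall>\<^sub>F n in sequentially. 3 / 4 \<le> ?P n (cl n)"
    unfolding cl_def u_def using as by (intro eventually_disjoint_cliques)
  moreover have "\<forall>\<^sub>F n in sequentially. u0 \<le> u n"
  proof -
    have "0 < s" using \<open>a < s\<close> as by simp
    then have "filterlim u at_top sequentially" unfolding u_def by real_asymp
    then show ?thesis by (simp add: filterlim_at_top)
  qed
  ultimately have "\<forall>\<^sub>F n in sequentially. 1 / 2 \<le> ?P n ?good"
    using eventually_gt_at_top[of 0]
  proof eventually_elim
    case (elim n)
    have q: "0 \<le> real n powr (- a)" "real n powr (- a) \<le> 1"
      using elim(4) as by (auto simp: powr_minus intro!: inverse_le_1_iff[THEN iffD2] ge_one_powr_ge_zero)
    have "?P n (bad n) \<le> 1 / 4"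
      using pb[rule_format, OF elim(3) q] elim(1) unfolding bad_def by (rule order_trans)
    moreover have "?P n (cl n) \<le> ?P n ?good + ?P n (bad n)"
    proof -
      \<comment> \<open>Only graphs in the support are known to have vertex set
        \<open>{..<n}\<close>.\<close>
      have "?P n (cl n) = ?P n (cl n \<inter> set_pmf (gnp n (real n powr (- a))))"
        by (simp add: measure_Int_set_pmf)
      also have "\<dots> \<le> ?P n (?good \<union> bad n)"
      proof (rule measure_pmf.finite_measure_mono)
        show "cl n \<inter> set_pmf (gnp n (real n powr (- a))) \<subseteq> ?good \<union> bad n"
        proof
          fix G assume "G \<in> cl n \<inter> set_pmf (gnp n (real n powr (- a)))"
          then obtain \<S> where G: "uverts G = {..<n}"
            and \<S>: "u n \<le> card \<S>" "disjoint \<S>" "\<forall>Q\<in>\<S>. Q \<subseteq> {..<n} \<and> card Q = 4 \<and> pairs Q \<subseteq> uedges G"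
            using set_gnp by (auto simp: cl_def)
          show "G \<in> ?good \<union> bad n"
          proof (cases "G \<in> bad n")
            case False
            then have "arrows G (rooted_product F (transitive_tournament 3) r)"
              unfolding bad_def mem_Collect_eq by (rule arrows_rooted_product_TT3[OF pd r G \<S>])
            then show ?thesis by simp
          qed simp
        qed
      qed simp
      also have "\<dots> \<le> ?P n ?good + ?P n (bad n)" by (rule measure_Un_le) auto
      finally show ?thesis .
    qed
    ultimately show ?case using elim(2) by linarith
  qed
  then show ?thesis using as(1) by blast
qed

text \<open>If p >= \<open>\<epsilon>\<close> b held for infinitely many n, the density n^(-a) at
  those n, and 0 elsewhere, would lie far below the threshold; its arrowing probabilities would tend
  to 0 although they are eventually at least 1/2 at those n.\<close>

theorem theorem3:
  fixes F :: "'a pair_pre_digraph" and r :: nat and p :: "nat \<Rightarrow> real"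
  assumes "acyclically_oriented F"
    and "pverts F \<noteq> {}"
    and "1 < m2 (underlying F)" and "m2 (underlying F) < 2"
    and "r \<in> pverts (transitive_tournament 3)"
    and "is_threshold
           (\<lambda>G. arrows G (rooted_product F (transitive_tournament 3) r)) p"
  shows "p \<lless> (\<lambda>n. real n powr
           (- 1 / m2 (underlying (rooted_product F (transitive_tournament 3) r))))"
proof -
  let ?H = "rooted_product F (transitive_tournament 3) r"
  let ?P = "\<lambda>n q. measure_pmf.prob (gnp n q) {G. arrows G ?H}"
  define b where "b n = real n powr (- 1 / m2 (underlying ?H))" for n :: nat
  have pd: "pair_digraph F" using assms(1) by (simp add: acyclically_oriented_def oriented_graph_def)
  have m: "2 \<le> m2 (underlying ?H)" by (rule two_le_m2_rooted_product_TT3[OF pd assms(2,5)])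
  \<comment> \<open>A 2-density of at least 2 puts \<open>b\<close> at or above n^(-1/2), a
    polynomial factor above n^(-a).\<close>
  have b: "0 < b n" "real n powr (- (1 / 2)) \<le> b n" if "0 < n" for n
    using that m unfolding b_def by (auto intro!: powr_mono simp: field_simps)
  obtain a where a: "1 / 2 < a" and hi: "\<forall>\<^sub>F n in sequentially. 1 / 2 \<le> ?P n (real n powr (- a))"
    using eventually_arrows_rooted_product_TT3[OF assms(1-5)] by blast
  have p_pos: "\<forall>\<^sub>F n in sequentially. 0 < p n"
    and lo: "\<And>q. (\<forall>n. 0 \<le> q n \<and> q n \<le> 1) \<Longrightarrow> q \<lless> p \<Longrightarrow> (\<lambda>n. ?P n (q n)) \<longlonglongrightarrow> 0"
    using assms(6) unfolding is_threshold_def by blast+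
  have "(\<lambda>n. p n / b n) \<longlonglongrightarrow> 0"
  proof (rule tendstoI)
    fix \<epsilon> :: real assume \<epsilon>: "0 < \<epsilon>"
    define big where "big n \<longleftrightarrow> 0 < n \<and> \<epsilon> \<le> p n / b n" for n
    \<comment> \<open>The value 0 where \<open>p\<close> is small makes \<open>q\<close> much less
      than \<open>p\<close> along the whole sequence, as the definition of a threshold
      demands.\<close>
    define q where "q n = (if big n then real n powr (- a) else 0)" for n
    have q01: "0 \<le> q n \<and> q n \<le> 1" for n
      using a by (auto simp: q_def big_def powr_minus intro!: inverse_le_1_iff[THEN iffD2] ge_one_powr_ge_zero)
    have "(\<lambda>n. q n / p n) \<longlonglongrightarrow> 0"
    proof (rule tendsto_sandwich[where f = "\<lambda>_. 0" and h = "\<lambda>n. real n powr (1 / 2 - a) / \<epsilon>"])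
      show "(\<lambda>n::nat. real n powr (1 / 2 - a) / \<epsilon>) \<longlonglongrightarrow> 0"
        using a \<epsilon> by real_asymp
      show "\<forall>\<^sub>F n in sequentially. 0 \<le> q n / p n"
        using p_pos by eventually_elim (use q01 in auto)
      show "\<forall>\<^sub>F n in sequentially. q n / p n \<le> real n powr (1 / 2 - a) / \<epsilon>"
        using p_pos
      proof eventually_elim
        case (elim n)
        show ?case
        proof (cases "big n")
          case True
          then have n: "0 < n" and "\<epsilon> * b n \<le> p n"
            using b(1)[of n] by (auto simp: big_def field_simps)
          then have "\<epsilon> * real n powr (- (1 / 2)) \<le> p n"
            using mult_left_mono[OF b(2)[OF n] less_imp_le[OF \<epsilon>]] by linarith
          then have "q n / p n \<le> real n powr (- a) / (\<epsilon> * real n powr (- (1 / 2)))"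
            using True n \<epsilon> unfolding q_def by (simp add: frac_le)
          also have "\<dots> = real n powr (1 / 2 - a) / \<epsilon>"
          proof -
            have "real n powr (- a) / real n powr (- (1 / 2)) = real n powr (1 / 2 - a)"
              by (simp add: powr_diff[symmetric])
            then show ?thesis by (metis divide_divide_eq_left mult.commute)
          qed
          finally show ?thesis .
        qed (use \<epsilon> in \<open>simp add: q_def\<close>)
      qed
    qed simp
    then have "q \<lless> p"
      unfolding much_less_def using p_pos by (auto elim: eventually_mono)
    from lo[OF _ this] q01 have "(\<lambda>n. ?P n (q n)) \<longlonglongrightarrow> 0" by blast
    then have "\<forall>\<^sub>F n in sequentially. ?P n (q n) < 1 / 2" by (rule order_tendstoD) simp
    then show "\<forall>\<^sub>F n in sequentially. dist (p n / b n) 0 < \<epsilon>"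
      using hi p_pos eventually_gt_at_top[of 0]
    proof eventually_elim
      case (elim n)
      then have "\<not> big n" by (auto simp: q_def)
      then show ?case using elim b(1)[of n] by (simp add: big_def)
    qed
  qed
  moreover have "\<forall>\<^sub>F n in sequentially. b n \<noteq> 0"
    using eventually_gt_at_top[of 0]
  proof eventually_elim
    case (elim n)
    show ?case using b(1)[OF elim] by simp
  qed
  ultimately show ?thesis unfolding much_less_def b_def by simp
qed

end
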